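(* Let $A\in\mathbb{R}^{M\times N}$, $b\in\mathbb{R}^M$, $\ell\ge 1$, $1\le k\le m$, and $\lambda\ge 0$. Run $m+\ell$ iterations of standard Golub-Kahan bidiagonalization (GKB), obtaining $V_{m+\ell}$, $U_{m+\ell+1}$, $B_{m+\ell}$ and in particular $B_m$ and $\alpha_{m+1}$. Let $B_m=\Psi_{m+1}\Sigma_m\Phi_m^\top$ be the SVD of $B_m$ with singular values $\sigma_1\ge\dots\ge\sigma_m$. Let the recycled space be obtained by TSVD compression, i.e. $W_{k-1}=V_m\Phi_{k-1}$, where $\Phi_{k-1}$ consists of the first $k-1$ columns of $\Phi_m$; let $x^{(1)}\in\mathcal{R}(V_m)$ be a regularized solution with $x^{(1)}\notin\mathcal{R}(W_{k-1})$, and let $W_k=[W_{k-1}\ \ \check{x}^{(1)}]$. Carry out $\ell$ iterations of recycling GKB, obtaining $Y_k$, $R_k$, $\widetilde V_\ell$, $\widetilde U_{\ell+1}$, $\widetilde B_\ell$, $\widetilde\alpha_{\ell+1}$, $\widehat B_{k,\ell}$, and let $r_{kk}$ be the $(k,k)$ entry of $R_k$. Let $T=[T_1\ T_2\ T_c]$ and $Z=[Z_1\ Z_2\ Z_c]$ be orthogonal matrices as in the context, and let $\widehat r_\lambda$ and $r_\lambda$ be the residuals defined in the context. Then $$\|r_\lambda\|_2\ \le\ \|\widehat r_\lambda\|_2\left(\sigma_k^2-r_{kk}^2+\alpha_{m+1}^2-\|Y_k^\top A\widetilde V_\ell\|_F^2+\widetilde\alpha_{\ell+1}^2\right)^{1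/2}.$$
   Context: Exact arithmetic and no breakdown are assumed: all normalization scalars $\alpha_j,\beta_j,\widetilde\alpha_j,\widetilde\beta_j$ generated below are nonzero. $\mathcal{R}(\cdot)$ is column space; $e_j$ is the $j$-th standard basis vector of the appropriate dimension. Standard GKB: $\beta_1=\|b\|_2$, $u_1=b/\beta_1$, $\alpha_1v_1=A^\top u_1$, and for $j\ge1$, $\beta_{j+1}u_{j+1}=Av_j-\alpha_ju_j$, $\alpha_{j+1}v_{j+1}=A^\top u_{j+1}-\beta_{j+1}v_j$, with the scalars being positive and normalizing the vectors to unit length. $V_n=[v_1\cdots v_n]$, $U_{n+1}=[u_1\cdots u_{n+1}]$ (orthonormal columns), and $B_n\in\mathbb{R}^{(n+1)\times n}$ is lower bidiagonal with $(B_n)_{j,j}=\alpha_j$, $(B_n)_{j+1,j}=\beta_{j+1}$; thus $AV_n=U_{n+1}B_n$. Recycling GKB: given $W_{k-1}\in\mathbb{R}^{N\times(k-1)}$ with orthonormal columns and a vector $x^{(1)}\notin\mathcal{R}(W_{k-1})$, put $\check x^{(1)}=(x^{(1)}-W_{k-1}W_{k-1}^\top x^{(1)})/\|x^{(1)}-W_{k-1}W_{k-1}^\top x^{(1)}\|_2$ and $W_k=[W_{k-1}\ \check x^{(1)}]$. Let $AW_k=Y_kR_k$ be the skinny QR factorization ($Y_k\in\mathbb{R}^{M\times k}$ orthonormal columns, $R_k\in\mathbb{R}^{k\times k}$ upper triangular). Let $\check r^{(1)}=b-A\check x^{(1)}$, $\zeta=Y_k^\top\check r^{(1)}$, $\widetilde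 b=\check r^{(1)}-Y_k\zeta$, $\widetilde\beta_1=\|\widetilde b\|_2$, $\widetilde u_1=\widetilde b/\widetilde\beta_1$, $\widetilde\alpha_1\widetilde v_1=A^\top\widetilde u_1$, and for $j=1,\dots,\ell$: $\widetilde\beta_{j+1}\widetilde u_{j+1}=(I-Y_kY_k^\top)A\widetilde v_j-\widetilde\alpha_j\widetilde u_j$, $\widetilde\alpha_{j+1}\widetilde v_{j+1}=A^\top\widetilde u_{j+1}-\widetilde\beta_{j+1}\widetilde v_j$, with positive normalizing scalars. Put $\widetilde V_\ell=[\widetilde v_1\cdots\widetilde v_\ell]$, $\widetilde U_{\ell+1}=[\widetilde u_1\cdots\widetilde u_{\ell+1}]$, and let $\widetilde B_\ell\in\mathbb{R}^{(\ell+1)\times\ell}$ be lower bidiagonal with diagonal $\widetilde\alpha_j$ and subdiagonal $\widetilde\beta_{j+1}$. Set $$\widehat B_{k,\ell}=\begin{bmatrix}R_k & Y_k^\top A\widetilde V_\ell\\ 0&\widetilde B_\ell\end{bmatrix}\in\mathbb{R}^{(k+\ell+1)\times(k+\ell)}.$$ Orthogonal matrices: $T=[T_1\ T_2\ T_c]\in\mathbb{R}^{(m+\ell+1)\times(m+\ell+1)}$ and $Z=[Z_1\ Z_2\ Z_c]\in\mathbb{R}^{(m+\ell)\times(m+\ell)}$ are orthogonal with $Y_k=U_{m+\ell+1}T_1$, $\widetilde U_{\ell+1}=U_{m+\ell+1}T_2$, $W_k=V_{m+\ell}Z_1$, $\widetilde V_\ell=V_{m+\ell}Z_2$ (such matrices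 exist). Residuals: let $g=\begin{bmatrix}\zeta+R_ke_k\\ \widetilde\beta_1e_1\end{bmatrix}\in\mathbb{R}^{k+\ell+1}$, let $\widetilde y_\lambda=\arg\min_y\|\widehat B_{k,\ell}y-g\|_2^2+\lambda^2\|y\|_2^2$, and $\widehat r_\lambda=g-\widehat B_{k,\ell}\widetilde y_\lambda$. With $G=T^\top B_{m+\ell}Z$, let $$r_\lambda=G^\top T^\top\beta_1e_1-(G^\top G+\lambda^2I)\begin{bmatrix}\widetilde y_\lambda\\0\end{bmatrix},$$ the residual of $[\widetilde y_\lambda^\top\ 0^\top]^\top$ in the normal equations of the transformed full Tikhonov problem. The regularized solution $x^{(1)}$ may be any vector of $\mathcal{R}(V_m)$ not in $\mathcal{R}(W_{k-1})$. *)

theory Defs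
  imports Complex_Main "Jordan_Normal_Form.VS_Connect"
begin

(* The dimensions k, l, m vary inside the statement, so vectors and matrices are the
   carrier-based ones of Jordan_Normal_Form.  Entries are indexed from 0, whereas the sequences
   of Golub-Kahan vectors and scalars below are indexed from 1; values at 0 are irrelevant. *)

definition norm2 :: "real vec \<Rightarrow> real" where
  "norm2 v = sqrt (v \<bullet> v)"

definition frobenius_norm :: "real mat \<Rightarrow> real" where
  "frobenius_norm A = sqrt (\<Sum>i<dim_row A. \<Sum>j<dim_col A. (A $$ (i, j))\<^sup>2)"

definition orthonormal_cols :: "real mat \<Rightarrow> bool" where
  "orthonormal_cols Q \<longleftrightarrow> Q\<^sup>T * Q = 1\<^sub>m (dim_col Q)"

(* Not Matrix.orthogonal_mat, whose columns need not have unit length. *)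
definition real_orthogonal_mat :: "nat \<Rightarrow> real mat \<Rightarrow> bool" where
  "real_orthogonal_mat n Q \<longleftrightarrow> Q \<in> carrier_mat n n \<and> orthonormal_cols Q"

definition append_cols :: "real mat \<Rightarrow> real mat \<Rightarrow> real mat"
    (infixr "@\<^sub>c" 65) where
  "A @\<^sub>c B = (A\<^sup>T @\<^sub>r B\<^sup>T)\<^sup>T"

(* The matrix [v 1, ..., v n]. *)
definition cols_upto :: "nat \<Rightarrow> (nat \<Rightarrow> real vec) \<Rightarrow> nat \<Rightarrow> real mat" where
  "cols_upto d v n = mat_of_cols d (map v [1..<n+1])"

(* In 1-based indices: entry (j, j) is \<alpha> j and entry (j + 1, j) is \<beta> (j + 1). *)
definition bidiag :: "(nat \<Rightarrow> real) \<Rightarrow> (nat \<Rightarrow> real) \<Rightarrow> nat \<Rightarrow> real mat" where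
  "bidiag \<alpha> \<beta> n = mat (n + 1) n
     (\<lambda>(i, j). if i = j then \<alpha> (j + 1) else if i = j + 1 then \<beta> (j + 2) else 0)"

(* n iterations of Golub-Kahan bidiagonalization without breakdown, producing u 1, ..., u (n+1)
   and v 1, ..., v n.  Nothing is required of \<alpha> (n+1) and v (n+1), which do not occur in the
   matrices U_(n+1), V_n, B_n.  Orthogonality of the vectors is a consequence. *)
definition gkb ::
  "real mat \<Rightarrow> real vec \<Rightarrow> nat \<Rightarrow> (nat \<Rightarrow> real) \<Rightarrow> (nat \<Rightarrow> real)
    \<Rightarrow> (nat \<Rightarrow> real vec) \<Rightarrow> (nat \<Rightarrow> real vec) \<Rightarrow> bool" where
  "gkb A b n \<alpha> \<beta> u v \<longleftrightarrow>
     (\<forall>j\<in>{1..n+1}. u j \<in> carrier_vec (dim_row A) \<and> norm2 (u j) = 1 \<and> 0 < \<beta> j) \<and>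
     (\<forall>j\<in>{1..n}. v j \<in> carrier_vec (dim_col A) \<and> norm2 (v j) = 1 \<and> 0 < \<alpha> j) \<and>
     \<beta> 1 = norm2 b \<and> u 1 = (1 / \<beta> 1) \<cdot>\<^sub>v b \<and>
     (1 \<le> n \<longrightarrow> \<alpha> 1 \<cdot>\<^sub>v v 1 = A\<^sup>T *\<^sub>v u 1) \<and>
     (\<forall>j\<in>{1..n}. \<beta> (j+1) \<cdot>\<^sub>v u (j+1) = A *\<^sub>v v j - \<alpha> j \<cdot>\<^sub>v u j) \<and>
     (\<forall>j\<in>{1..<n}. \<alpha> (j+1) \<cdot>\<^sub>v v (j+1) = A\<^sup>T *\<^sub>v u (j+1) - \<beta> (j+1) \<cdot>\<^sub>v v j)"

(* l iterations of the recycling variant with starting vector b; here the scalar \<alpha> (l+1) and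
   the vector v (l+1) are part of the output. *)
definition recycling_gkb ::
  "real mat \<Rightarrow> real mat \<Rightarrow> real vec \<Rightarrow> nat \<Rightarrow> (nat \<Rightarrow> real) \<Rightarrow> (nat \<Rightarrow> real)
    \<Rightarrow> (nat \<Rightarrow> real vec) \<Rightarrow> (nat \<Rightarrow> real vec) \<Rightarrow> bool" where
  "recycling_gkb A Y b l \<alpha> \<beta> u v \<longleftrightarrow>
     (\<forall>j\<in>{1..l+1}. u j \<in> carrier_vec (dim_row A) \<and> norm2 (u j) = 1 \<and> 0 < \<beta> j) \<and>
     (\<forall>j\<in>{1..l+1}. v j \<in> carrier_vec (dim_col A) \<and> norm2 (v j) = 1 \<and> 0 < \<alpha> j) \<and>
     \<beta> 1 = norm2 b \<and> u 1 = (1 / \<beta> 1) \<cdot>\<^sub>v b \<and>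
     \<alpha> 1 \<cdot>\<^sub>v v 1 = A\<^sup>T *\<^sub>v u 1 \<and>
     (\<forall>j\<in>{1..l}.
        \<beta> (j+1) \<cdot>\<^sub>v u (j+1)
          = (1\<^sub>m (dim_row A) - Y * Y\<^sup>T) *\<^sub>v (A *\<^sub>v v j) - \<alpha> j \<cdot>\<^sub>v u j \<and>
        \<alpha> (j+1) \<cdot>\<^sub>v v (j+1) = A\<^sup>T *\<^sub>v u (j+1) - \<beta> (j+1) \<cdot>\<^sub>v v j)"

(* Full singular value decomposition B = \<Psi> \<Sigma> \<Phi>^T with square orthogonal factors;
   \<sigma> 1, \<sigma> 2, ... are the singular values. *)
definition is_svd ::
  "real mat \<Rightarrow> real mat \<Rightarrow> (nat \<Rightarrow> real) \<Rightarrow> real mat \<Rightarrow> bool" where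
  "is_svd B \<Psi> \<sigma> \<Phi> \<longleftrightarrow>
     real_orthogonal_mat (dim_row B) \<Psi> \<and> real_orthogonal_mat (dim_col B) \<Phi> \<and>
     (\<forall>i\<in>{1..min (dim_row B) (dim_col B)}. 0 \<le> \<sigma> i) \<and>
     (\<forall>i\<in>{1..min (dim_row B) (dim_col B)}. \<forall>j\<in>{i..min (dim_row B) (dim_col B)}. \<sigma> j \<le> \<sigma> i) \<and>
     B = \<Psi> * mat (dim_row B) (dim_col B) (\<lambda>(i, j). if i = j then \<sigma> (j + 1) else 0) * \<Phi>\<^sup>T"

(* No sign is imposed on the diagonal of R. *)
definition is_skinny_qr :: "real mat \<Rightarrow> real mat \<Rightarrow> real mat \<Rightarrow> bool" where
  "is_skinny_qr C Y R \<longleftrightarrow>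
     Y \<in> carrier_mat (dim_row C) (dim_col C) \<and> orthonormal_cols Y \<and>
     R \<in> carrier_mat (dim_col C) (dim_col C) \<and> upper_triangular R \<and> C = Y * R"

abbreviation column_space :: "real mat \<Rightarrow> real vec set" where
  "column_space B \<equiv> vec_space.col_space (dim_row B) B"

end

theory Submission
  imports Defs "HOL-Analysis.L2_Norm"
begin

text \<open>
  Put \<open>Q = U T\<close> and \<open>P = V Z\<close>.  Both have orthonormal columns, \<open>G = Q\<^sup>T A P\<close>, and they split as
  \<open>Q = [Q1 Q2]\<close>, \<open>P = [P1 P2]\<close> with the recycled parts \<open>Q1 = [Y Ul]\<close> and \<open>P1 = [W Vl]\<close>.  The recycling
  process gives \<open>A P1 = Q1 Bhat\<close> and \<open>b = Q1 g\<close>, so \<open>G\<close> is block upper triangular with diagonal block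
  \<open>Bhat\<close> and coupling block \<open>C = Q1\<^sup>T A P2\<close>.  The recycled minimizer, padded by zeros, satisfies the part
  of the full normal equations that belongs to \<open>P1\<close>; the part that belongs to \<open>P2\<close> has the residual
  \<open>C\<^sup>T rhat\<close>.  Therefore \<open>\<parallel>r\<parallel> \<le> \<parallel>rhat\<parallel> \<parallel>C\<parallel>\<^sub>F\<close> (lemma \<open>full_residual_le\<close>), and everything else
  is an estimate of \<open>C\<close>.

  The rows of \<open>C\<close> that belong to \<open>Ul\<close> are controlled by the transposed recurrence: \<open>Ul\<^sup>T A\<close> leaves the
  range of \<open>Vl\<close> only through the last scalar, so these rows contribute at most
  \<open>(\<alpha>' (l + 1))\<^sup>2\<close> (lemma \<open>recycling_gkb_tail_le\<close>).

  The rows that belong to \<open>Y\<close> are what remains of \<open>Y\<^sup>T A V\<close> after \<open>Y\<^sup>T A W = R\<close> and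
  \<open>Y\<^sup>T A Vl\<close> have been taken away, since \<open>Z\<close> is orthogonal:
  \<open>\<parallel>Y\<^sup>T A P2\<parallel>\<^sup>2 = \<parallel>Y\<^sup>T A V\<parallel>\<^sup>2 - \<parallel>R\<parallel>\<^sup>2 - \<parallel>Y\<^sup>T A Vl\<parallel>\<^sup>2\<close> in Frobenius norms.
  The range of \<open>Y\<close> lies in the span of \<open>u 1, \<dots>, u (m + 1)\<close> (lemma \<open>qr_factor_range\<close>), so \<open>Y\<^sup>T A V\<close>
  consists of a \<open>k\<close>-dimensional compression of \<open>Bm\<close> and one further column governed by
  \<open>\<alpha> (m + 1)\<close> (lemma \<open>frobenius_transpose_mult_gkb_le\<close>).  By Ky Fan the compression has at most the energy
  \<open>(\<sigma> 1)\<^sup>2 + \<dots> + (\<sigma> k)\<^sup>2\<close> (lemma \<open>frobenius_svd_le\<close>).  Conversely \<open>R\<close> has at least the energy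
  \<open>(\<sigma> 1)\<^sup>2 + \<dots> + (\<sigma> (k - 1))\<^sup>2\<close> plus the square of its last diagonal entry, because its first \<open>k - 1\<close>
  columns come from singular vectors (lemma \<open>tsvd_triangular_factor_energy\<close>).  In the difference the first
  \<open>k - 1\<close> singular values cancel, which is the reason for compressing by truncated SVD.
\<close>

section \<open>Norms of vectors and matrices\<close>

lemma norm2_sq_sum: "(norm2 v)\<^sup>2 = (\<Sum>i<dim_vec v. (v $ i)\<^sup>2)"
proof -
  have "v \<bullet> v = (\<Sum>i<dim_vec v. (v $ i)\<^sup>2)"
    by (simp add: scalar_prod_def power2_eq_square lessThan_atLeast0)
  then show ?thesis
    by (simp add: norm2_def sum_nonneg)
qed

lemma norm2_sq: "(norm2 v)\<^sup>2 = v \<bullet> v"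
  unfolding norm2_sq_sum by (simp add: scalar_prod_def power2_eq_square lessThan_atLeast0)

lemma norm2_nonneg: "0 \<le> norm2 v"
proof -
  have "0 \<le> v \<bullet> v"
    using norm2_sq[of v] by (metis zero_le_power2)
  then show ?thesis
    by (simp add: norm2_def)
qed

lemma norm2_smult_sq: "(norm2 (c \<cdot>\<^sub>v v))\<^sup>2 = c\<^sup>2 * (norm2 v)\<^sup>2"
  by (simp add: norm2_sq_sum power_mult_distrib sum_distrib_left)

lemma norm2_zero: "norm2 (0\<^sub>v n) = 0"
  by (simp add: norm2_def scalar_prod_def)

lemma norm2_unit: "i < n \<Longrightarrow> norm2 (unit_vec n i) = 1"
  by (simp add: norm2_def)

lemma norm2_append_sq: "(norm2 (v @\<^sub>v w))\<^sup>2 = (norm2 v)\<^sup>2 + (norm2 w)\<^sup>2"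
  unfolding norm2_sq
  by (rule scalar_prod_append[of _ "dim_vec v" _ "dim_vec w"]) auto

lemma norm2_eq_zero:
  assumes "norm2 v = 0" "v \<in> carrier_vec n"
  shows "v = 0\<^sub>v n"
proof -
  have "(\<Sum>i<dim_vec v. (v $ i)\<^sup>2) = 0"
    using assms(1) norm2_sq_sum[of v] by simp
  then have "\<forall>i<dim_vec v. v $ i = 0"
    by (simp add: sum_nonneg_eq_0_iff)
  then show ?thesis
    using assms(2) by (intro eq_vecI) auto
qed

lemma cauchy_schwarz_sq:
  assumes "dim_vec v = dim_vec w"
  shows "(v \<bullet> w)\<^sup>2 \<le> (norm2 v)\<^sup>2 * (norm2 w)\<^sup>2"
proof -
  have n: "norm2 z = L2_set (($) z) {..<dim_vec z}" for z
    using norm2_nonneg norm2_sq_sum by (metis L2_set_def real_sqrt_abs abs_of_nonneg)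
  have "\<bar>v \<bullet> w\<bar> \<le> (\<Sum>i<dim_vec w. \<bar>v $ i\<bar> * \<bar>w $ i\<bar>)"
    unfolding scalar_prod_def lessThan_atLeast0[symmetric]
    by (rule order_trans[OF sum_abs]) (simp add: abs_mult)
  also have "\<dots> \<le> norm2 v * norm2 w"
    unfolding n assms by (rule L2_set_mult_ineq)
  finally have "\<bar>v \<bullet> w\<bar>\<^sup>2 \<le> (norm2 v * norm2 w)\<^sup>2"
    by (rule power_mono) simp
  then show ?thesis
    by (simp add: power_mult_distrib)
qed

lemma frobenius_sq: "(frobenius_norm A)\<^sup>2 = (\<Sum>i<dim_row A. \<Sum>j<dim_col A. (A $$ (i, j))\<^sup>2)"
  by (simp add: frobenius_norm_def sum_nonneg)

lemma frobenius_sq_cols: "(frobenius_norm A)\<^sup>2 = (\<Sum>j<dim_col A. (norm2 (col A j))\<^sup>2)"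
  unfolding frobenius_sq norm2_sq_sum by (subst sum.swap) simp

lemma frobenius_sq_rows: "(frobenius_norm A)\<^sup>2 = (\<Sum>i<dim_row A. (norm2 (row A i))\<^sup>2)"
  unfolding frobenius_sq norm2_sq_sum by simp

lemma frobenius_transpose: "(frobenius_norm A\<^sup>T)\<^sup>2 = (frobenius_norm A)\<^sup>2"
  unfolding frobenius_sq_cols[of "A\<^sup>T"] frobenius_sq_rows[of A] by simp

text \<open>
  Row by row Cauchy-Schwarz: the Frobenius norm dominates the operator norm.  This is the only
  estimate that turns the block coupling the two subspaces into a bound on a residual.
\<close>

lemma norm2_mult_mat_vec_sq_le:
  assumes "v \<in> carrier_vec (dim_col A)"
  shows "(norm2 (A *\<^sub>v v))\<^sup>2 \<le> (frobenius_norm A)\<^sup>2 * (norm2 v)\<^sup>2"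
proof -
  have "(norm2 (A *\<^sub>v v))\<^sup>2 = (\<Sum>i<dim_row A. (row A i \<bullet> v)\<^sup>2)"
    by (simp add: norm2_sq_sum)
  also have "\<dots> \<le> (\<Sum>i<dim_row A. (norm2 (row A i))\<^sup>2 * (norm2 v)\<^sup>2)"
    using assms by (intro sum_mono cauchy_schwarz_sq) auto
  finally show ?thesis
    by (simp add: frobenius_sq_rows sum_distrib_right)
qed

section \<open>Juxtaposed blocks\<close>

text \<open>
  Juxtaposition is defined by stacking transposed blocks.  The lemmas of this part express it through
  entries and columns, the form in which it interacts with products and norms.
\<close>

lemma append_cols_carrier:
  assumes "A \<in> carrier_mat n c" "B \<in> carrier_mat n d"
  shows "A @\<^sub>c B \<in> carrier_mat n (c + d)"
  using assms unfolding append_cols_def by (simp add: carrier_append_rows)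

lemma index_append_cols:
  assumes "A \<in> carrier_mat n c" "B \<in> carrier_mat n d" "i < n" "j < c + d"
  shows "(A @\<^sub>c B) $$ (i, j) = (if j < c then A $$ (i, j) else B $$ (i, j - c))"
  using assms unfolding append_cols_def append_rows_def by auto

lemma append_cols_assoc:
  assumes A: "A \<in> carrier_mat n c" and B: "B \<in> carrier_mat n d" and C: "C \<in> carrier_mat n e"
  shows "(A @\<^sub>c B) @\<^sub>c C = A @\<^sub>c B @\<^sub>c C"
proof -
  note AB = append_cols_carrier[OF A B] and BC = append_cols_carrier[OF B C]
  show ?thesis
    using append_cols_carrier[OF AB C] append_cols_carrier[OF A BC]
    by (intro eq_matI)
      (auto simp: index_append_cols[OF A BC] index_append_cols[OF AB C]
        index_append_cols[OF A B] index_append_cols[OF B C])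
qed

lemma col_append_cols:
  assumes A: "A \<in> carrier_mat n c" and B: "B \<in> carrier_mat n d" and "j < c + d"
  shows "col (A @\<^sub>c B) j = (if j < c then col A j else col B (j - c))"
  using assms append_cols_carrier[OF A B]
  by (intro eq_vecI) (auto simp: index_append_cols[OF A B])

lemma mult_append_cols:
  assumes X: "X \<in> carrier_mat r n" and A: "A \<in> carrier_mat n c" and B: "B \<in> carrier_mat n d"
  shows "X * (A @\<^sub>c B) = (X * A) @\<^sub>c (X * B)"
proof -
  have XA: "X * A \<in> carrier_mat r c" and XB: "X * B \<in> carrier_mat r d"
    using assms by auto
  show ?thesis
    using assms append_cols_carrier[OF A B] append_cols_carrier[OF XA XB]
    by (intro eq_matI) (auto simp: index_append_cols[OF XA XB] col_append_cols[OF A B])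
qed

lemma transpose_append_cols_mult_append_cols:
  assumes A: "A \<in> carrier_mat n c" and B: "B \<in> carrier_mat n d"
    and C: "C \<in> carrier_mat n e" and D: "D \<in> carrier_mat n f"
  shows "(A @\<^sub>c B)\<^sup>T * (C @\<^sub>c D) =
    four_block_mat (A\<^sup>T * C) (A\<^sup>T * D) (B\<^sup>T * C) (B\<^sup>T * D)"
  using assms append_cols_carrier[OF A B] append_cols_carrier[OF C D]
  by (intro eq_matI) (auto simp: col_append_cols[OF A B] col_append_cols[OF C D])

lemma mult_append_cols_append_vec:
  assumes A: "A \<in> carrier_mat n c" and B: "B \<in> carrier_mat n d"
    and x: "x \<in> carrier_vec c" and y: "y \<in> carrier_vec d"
  shows "(A @\<^sub>c B) *\<^sub>v (x @\<^sub>v y) = A *\<^sub>v x + B *\<^sub>v y"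
proof (rule eq_vecI)
  fix i assume "i < dim_vec (A *\<^sub>v x + B *\<^sub>v y)"
  then have i: "i < n" using B by simp
  have "row (A @\<^sub>c B) i = row A i @\<^sub>v row B i"
    using append_cols_carrier[OF A B] A B i
    by (intro eq_vecI) (auto simp: index_append_cols[OF A B])
  then show "((A @\<^sub>c B) *\<^sub>v (x @\<^sub>v y)) $ i = (A *\<^sub>v x + B *\<^sub>v y) $ i"
    using append_cols_carrier[OF A B] A B x y i by (simp add: scalar_prod_append[of _ c _ d])
qed (use append_cols_carrier[OF A B] A B in auto)

lemma transpose_append_cols_mult_vec:
  assumes A: "A \<in> carrier_mat n c" and B: "B \<in> carrier_mat n d" and x: "x \<in> carrier_vec n"
  shows "(A @\<^sub>c B)\<^sup>T *\<^sub>v x = (A\<^sup>T *\<^sub>v x) @\<^sub>v (B\<^sup>T *\<^sub>v x)"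
  using append_cols_carrier[OF A B] A B
  by (intro eq_vecI) (auto simp: col_append_cols[OF A B])

text \<open>
  The right-hand factor has the shape of the matrix \<open>Bhat\<close> of the recycled problem, with a
  vanishing lower left block.
\<close>

lemma append_cols_mult_four_block:
  assumes Y: "Y \<in> carrier_mat n c" and U: "U \<in> carrier_mat n d"
    and R: "R \<in> carrier_mat c e" and E: "E \<in> carrier_mat c f" and B: "B \<in> carrier_mat d f"
  shows "(Y @\<^sub>c U) * four_block_mat R E (0\<^sub>m d e) B = (Y * R) @\<^sub>c (Y * E + U * B)"
proof (rule mat_col_eqI)
  let ?F = "four_block_mat R E (0\<^sub>m d e) B"
  have F: "?F \<in> carrier_mat (c + d) (e + f)"
    by (rule four_block_carrier_mat[OF R B])
  have L: "Y * R \<in> carrier_mat n e" and RR: "Y * E + U * B \<in> carrier_mat n f"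
    using Y U R E B by auto
  note YU = append_cols_carrier[OF Y U] and LR = append_cols_carrier[OF L RR]
  fix j assume "j < dim_col (Y * R @\<^sub>c (Y * E + U * B))"
  then have j: "j < e + f"
    unfolding carrier_matD[OF LR] .
  show "col ((Y @\<^sub>c U) * ?F) j = col (Y * R @\<^sub>c (Y * E + U * B)) j"
  proof (cases "j < e")
    case True
    have cF: "col ?F j = col R j @\<^sub>v 0\<^sub>v d"
      using True R E B by (intro eq_vecI) auto
    have cR: "col R j \<in> carrier_vec c"
      using R by auto
    have "U *\<^sub>v 0\<^sub>v d = 0\<^sub>v n"
      using U by (intro eq_vecI) auto
    then have "col ((Y @\<^sub>c U) * ?F) j = Y *\<^sub>v col R j"
      using mult_mat_vec_carrier[OF Y cR]
      unfolding col_mult2[OF YU F j] cF mult_append_cols_append_vec[OF Y U cR zero_carrier_vec]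
      by simp
    then show ?thesis
      using True by (simp only: col_append_cols[OF L RR j] col_mult2[OF Y R] if_True)
  next
    case False
    then have i: "j - e < f"
      using j by simp
    have cF: "col ?F j = col E (j - e) @\<^sub>v col B (j - e)"
      using False j R E B by (intro eq_vecI) auto
    have c: "col E (j - e) \<in> carrier_vec c" "col B (j - e) \<in> carrier_vec d"
      using E B by auto
    have "col (Y * E + U * B) (j - e) = Y *\<^sub>v col E (j - e) + U *\<^sub>v col B (j - e)"
      using i Y U E B
      by (subst col_add[of _ n f]) (auto simp only: col_mult2[OF Y E i] col_mult2[OF U B i] mult_carrier_mat)
    then show ?thesis
      using False
      unfolding col_mult2[OF YU F j] cF mult_append_cols_append_vec[OF Y U c] col_append_cols[OF L RR j]
      by simp
  qed
qed (use append_cols_carrier[OF Y U] append_cols_carrier[of "Y * R" n e "Y * E + U * B" f] Y U R E B in auto)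

lemma frobenius_append_cols:
  assumes A: "A \<in> carrier_mat n c" and B: "B \<in> carrier_mat n d"
  shows "(frobenius_norm (A @\<^sub>c B))\<^sup>2 = (frobenius_norm A)\<^sup>2 + (frobenius_norm B)\<^sup>2"
proof -
  have split: "(\<Sum>j<c + d. f j) = (\<Sum>j<c. f j) + (\<Sum>j<d. f (c + j))" for f :: "nat \<Rightarrow> real"
    by (induction d) auto
  show ?thesis
    using assms append_cols_carrier[OF A B]
    by (simp add: frobenius_sq_cols split col_append_cols[OF A B])
qed

text \<open>
  The block rows of \<open>[A B]\<^sup>T X\<close> contribute separately; transposing makes them block columns.
\<close>

lemma frobenius_transpose_append_cols_mult:
  assumes A: "A \<in> carrier_mat n c" and B: "B \<in> carrier_mat n d" and X: "X \<in> carrier_mat n t"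
  shows "(frobenius_norm ((A @\<^sub>c B)\<^sup>T * X))\<^sup>2
    = (frobenius_norm (A\<^sup>T * X))\<^sup>2 + (frobenius_norm (B\<^sup>T * X))\<^sup>2"
proof -
  note AB = append_cols_carrier[OF A B]
  have Xt: "X\<^sup>T \<in> carrier_mat t n"
    using X by simp
  have flip: "(frobenius_norm (K\<^sup>T * X))\<^sup>2 = (frobenius_norm (X\<^sup>T * K))\<^sup>2" if K: "K \<in> carrier_mat n i" for K i
    using frobenius_transpose[of "X\<^sup>T * K"] transpose_mult[OF Xt K] by simp
  show ?thesis
    unfolding flip[OF AB] flip[OF A] flip[OF B] mult_append_cols[OF Xt A B]
    by (rule frobenius_append_cols[OF mult_carrier_mat[OF Xt A] mult_carrier_mat[OF Xt B]])
qed

lemma mult_unit_vec: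
  fixes X :: "real mat"
  assumes "X \<in> carrier_mat n c" "j < c"
  shows "X *\<^sub>v unit_vec c j = col X j"
  using assms by (intro eq_vecI) auto

lemma mult_mat_of_cols_single:
  fixes X :: "real mat"
  assumes X: "X \<in> carrier_mat n c" and z: "z \<in> carrier_vec c"
  shows "X * mat_of_cols c [z] = mat_of_cols n [X *\<^sub>v z]"
proof (rule mat_col_eqI)
  have Z: "mat_of_cols c [z] \<in> carrier_mat c 1"
    by (rule carrier_matI) simp_all
  fix j assume "j < dim_col (mat_of_cols n [X *\<^sub>v z])"
  then have j: "j < 1" by simp
  have Xz: "X *\<^sub>v z \<in> carrier_vec n"
    using X z by auto
  show "col (X * mat_of_cols c [z]) j = col (mat_of_cols n [X *\<^sub>v z]) j"
    unfolding col_mult2[OF X Z j] using j z Xz by simp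
qed (use X in auto)

section \<open>Orthonormal columns\<close>

lemma orthonormal_colsD: "orthonormal_cols Q \<Longrightarrow> Q \<in> carrier_mat n k \<Longrightarrow> Q\<^sup>T * Q = 1\<^sub>m k"
  by (auto simp: orthonormal_cols_def)

lemma orthonormal_cols_col_prod:
  assumes "orthonormal_cols Q" "i < dim_col Q" "j < dim_col Q"
  shows "col Q i \<bullet> col Q j = (if i = j then 1 else 0)"
proof -
  have "col Q i \<bullet> col Q j = (Q\<^sup>T * Q) $$ (i, j)"
    using assms by simp
  also have "\<dots> = (1\<^sub>m (dim_col Q) :: real mat) $$ (i, j)"
    using assms(1) by (simp only: orthonormal_cols_def)
  finally show ?thesis
    using assms(2,3) by simp
qed

lemma orthonormal_colsI:
  assumes "\<And>i j. i < dim_col Q \<Longrightarrow> j < dim_col Q \<Longrightarrow> col Q i \<bullet> col Q j = (if i = j then 1 else 0)"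
  shows "orthonormal_cols Q"
  unfolding orthonormal_cols_def by (intro eq_matI) (auto simp: assms)

lemma orthonormal_cols_mult:
  assumes Q: "Q \<in> carrier_mat n k" "orthonormal_cols Q"
    and P: "P \<in> carrier_mat k r" "orthonormal_cols P"
  shows "orthonormal_cols (Q * P)"
proof -
  have "(Q * P)\<^sup>T * (Q * P) = P\<^sup>T * ((Q\<^sup>T * Q) * P)"
    using Q(1) P(1) by (simp add: transpose_mult[of _ n k _ r] assoc_mult_mat[of _ r k _ n _ r]
        assoc_mult_mat[of _ k n _ k _ r])
  then show ?thesis
    using P Q(1) by (simp add: orthonormal_colsD[OF Q(2,1)] orthonormal_cols_def)
qed

text \<open>
  Coordinates with respect to an orthonormal basis of an orthonormal family are orthonormal,
  because \<open>Q\<^sup>T Q = 1\<close> can be cancelled from the Gram matrix of \<open>Q P\<close>.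
\<close>

lemma orthonormal_cols_of_mult:
  assumes Q: "Q \<in> carrier_mat n k" "orthonormal_cols Q"
    and P: "P \<in> carrier_mat k r" and QP: "orthonormal_cols (Q * P)"
  shows "orthonormal_cols P"
proof -
  have "(Q * P)\<^sup>T * (Q * P) = P\<^sup>T * ((Q\<^sup>T * Q) * P)"
    using Q(1) P(1) by (simp add: transpose_mult[of _ n k _ r] assoc_mult_mat[of _ r k _ n _ r]
        assoc_mult_mat[of _ k n _ k _ r])
  then show ?thesis
    using P Q(1) QP by (simp add: orthonormal_colsD[OF Q(2,1)] orthonormal_cols_def)
qed

lemma norm2_orthonormal_mult:
  assumes Q: "Q \<in> carrier_mat n k" "orthonormal_cols Q" and w: "w \<in> carrier_vec k"
  shows "(norm2 (Q *\<^sub>v w))\<^sup>2 = (norm2 w)\<^sup>2"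
proof -
  have "(Q *\<^sub>v w) \<bullet> (Q *\<^sub>v w) = (Q\<^sup>T *\<^sub>v (Q *\<^sub>v w)) \<bullet> w"
    using transpose_vec_mult_scalar[OF Q(1) w, of "Q *\<^sub>v w"] Q(1) w by simp
  also have "Q\<^sup>T *\<^sub>v (Q *\<^sub>v w) = w"
    using Q(1) w assoc_mult_mat_vec[of "Q\<^sup>T" k n Q k w] by (simp add: orthonormal_colsD[OF Q(2,1)])
  finally show ?thesis
    by (simp add: norm2_sq)
qed

text \<open>
  Expanding \<open>0 \<le> \<parallel>w - Q Q\<^sup>T w\<parallel>\<^sup>2\<close> leaves exactly
  \<open>\<parallel>w\<parallel>\<^sup>2 - \<parallel>Q\<^sup>T w\<parallel>\<^sup>2\<close>.
\<close>

lemma bessel_inequality: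
  assumes Q: "Q \<in> carrier_mat n k" "orthonormal_cols Q" and w: "w \<in> carrier_vec n"
  shows "(norm2 (Q\<^sup>T *\<^sub>v w))\<^sup>2 \<le> (norm2 w)\<^sup>2"
proof -
  define c where "c = Q\<^sup>T *\<^sub>v w"
  have c: "c \<in> carrier_vec k" and Qc: "Q *\<^sub>v c \<in> carrier_vec n"
    using Q w by (auto simp: c_def)
  have cross: "(Q *\<^sub>v c) \<bullet> w = (norm2 c)\<^sup>2"
    using transpose_vec_mult_scalar[OF Q(1) c w] comm_scalar_prod[OF w Qc]
    by (simp add: c_def norm2_sq)
  have "0 \<le> (norm2 (w - Q *\<^sub>v c))\<^sup>2"
    by simp
  also have "\<dots> = (norm2 w)\<^sup>2 - (norm2 c)\<^sup>2"
    using w Qc cross norm2_orthonormal_mult[OF Q c] comm_scalar_prod[OF w Qc]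
    by (simp add: norm2_sq minus_scalar_prod_distrib[of _ n] scalar_prod_minus_distrib[of _ n])
  finally show ?thesis
    by (simp add: c_def)
qed

lemma frobenius_orthonormal_mult:
  assumes Q: "Q \<in> carrier_mat n k" "orthonormal_cols Q" and X: "X \<in> carrier_mat k r"
  shows "(frobenius_norm (Q * X))\<^sup>2 = (frobenius_norm X)\<^sup>2"
proof -
  have "(norm2 (col (Q * X) j))\<^sup>2 = (norm2 (col X j))\<^sup>2" if "j < r" for j
    using norm2_orthonormal_mult[OF Q, of "col X j"] X that
    by (simp add: col_mult2[OF Q(1) X that])
  then show ?thesis
    using Q X by (simp add: frobenius_sq_cols)
qed

lemma orthonormal_cols_transpose:
  assumes Q: "Q \<in> carrier_mat n n" "orthonormal_cols Q"
  shows "orthonormal_cols Q\<^sup>T"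
  using mat_mult_left_right_inverse[of "Q\<^sup>T" n Q] Q orthonormal_colsD[OF Q(2,1)]
  by (simp add: orthonormal_cols_def)

lemma frobenius_mult_orthogonal:
  assumes Q: "Q \<in> carrier_mat n n" "orthonormal_cols Q" and X: "X \<in> carrier_mat r n"
  shows "(frobenius_norm (X * Q))\<^sup>2 = (frobenius_norm X)\<^sup>2"
proof -
  have "(frobenius_norm (X * Q))\<^sup>2 = (frobenius_norm (Q\<^sup>T * X\<^sup>T))\<^sup>2"
    using frobenius_transpose[of "X * Q"] Q X by (simp add: transpose_mult)
  also have "\<dots> = (frobenius_norm X\<^sup>T)\<^sup>2"
    using Q X orthonormal_cols_transpose[OF Q]
    by (intro frobenius_orthonormal_mult[of _ n n _ r]) auto
  finally show ?thesis
    by (simp add: frobenius_transpose)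
qed

text \<open>
  The four blocks of the Gram matrix of \<open>[A B]\<close> are those of the identity matrix.
\<close>

lemma append_cols_orthonormalD:
  assumes A: "A \<in> carrier_mat n c" and B: "B \<in> carrier_mat n d"
    and orth: "orthonormal_cols (A @\<^sub>c B)"
  shows "orthonormal_cols A" "orthonormal_cols B" "A\<^sup>T * B = 0\<^sub>m c d" "B\<^sup>T * A = 0\<^sub>m d c"
proof -
  note AB = append_cols_carrier[OF A B]
  have prod: "col (A @\<^sub>c B) i \<bullet> col (A @\<^sub>c B) j = (if i = j then 1 else 0)"
    if "i < c + d" "j < c + d" for i j
    using orthonormal_cols_col_prod[OF orth] that AB by auto
  have colB: "col (A @\<^sub>c B) (c + j) = col B j" if "j < d" for j
    using that by (simp add: col_append_cols[OF A B])
  have colA: "col (A @\<^sub>c B) j = col A j" if "j < c" for j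
    using that by (simp add: col_append_cols[OF A B])
  show "orthonormal_cols A"
    using A prod colA by (intro orthonormal_colsI) (metis carrier_matD(2) trans_less_add1)
  show "orthonormal_cols B"
    using B prod colB
    by (intro orthonormal_colsI) (metis add_left_cancel carrier_matD(2) nat_add_left_cancel_less)
  show "A\<^sup>T * B = 0\<^sub>m c d"
  proof (rule eq_matI)
    fix i j assume ij: "i < dim_row (0\<^sub>m c d)" "j < dim_col (0\<^sub>m c d)"
    then show "(A\<^sup>T * B) $$ (i, j) = (0\<^sub>m c d :: real mat) $$ (i, j)"
      using A B prod[of i "c + j"] colA[of i] colB[of j] by simp
  qed (use A B in auto)
  show "B\<^sup>T * A = 0\<^sub>m d c"
  proof (rule eq_matI)
    fix i j assume ij: "i < dim_row (0\<^sub>m d c)" "j < dim_col (0\<^sub>m d c)"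
    then show "(B\<^sup>T * A) $$ (i, j) = (0\<^sub>m d c :: real mat) $$ (i, j)"
      using A B prod[of "c + i" j] colA[of j] colB[of i] by simp
  qed (use A B in auto)
qed

section \<open>Singular values and the Ky Fan bound\<close>

text \<open>
  A bathtub argument: weights between 0 and 1 of total mass at most \<open>k\<close> do best by filling the
  \<open>k\<close> largest values.  Every summand is compared with the threshold value \<open>c = s (k - 1)\<close>: mass
  moved across the threshold, from an index below \<open>k\<close> to one above it, never increases the sum.
\<close>

lemma weighted_sum_le_top:
  fixes s d :: "nat \<Rightarrow> real"
  assumes k: "1 \<le> k" "k \<le> m"
    and s: "\<And>i. i < m \<Longrightarrow> 0 \<le> s i" "\<And>i j. i \<le> j \<Longrightarrow> j < m \<Longrightarrow> s j \<le> s i"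
    and d: "\<And>i. i < m \<Longrightarrow> 0 \<le> d i" "\<And>i. i < m \<Longrightarrow> d i \<le> 1" "(\<Sum>i<m. d i) \<le> real k"
  shows "(\<Sum>i<m. s i * d i) \<le> (\<Sum>i<k. s i)"
proof -
  define c where "c = s (k - 1)"
  have "(\<Sum>i<m. s i * d i) \<le> (\<Sum>i<m. c * d i + (if i < k then s i - c else 0))"
  proof (rule sum_mono)
    fix i assume "i \<in> {..<m}"
    then have i: "i < m" by simp
    show "s i * d i \<le> c * d i + (if i < k then s i - c else 0)"
    proof (cases "i < k")
      case True
      then have "0 \<le> (s i - c) * (1 - d i)"
        using s(2)[of i "k - 1"] k d(2)[OF i] by (intro mult_nonneg_nonneg) (auto simp: c_def)
      then show ?thesis
        using True by (simp add: algebra_simps)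
    next
      case False
      then show ?thesis
        using s(2)[of "k - 1" i] i d(1)[OF i] by (auto simp: c_def intro: mult_right_mono)
    qed
  qed
  also have "\<dots> = c * (\<Sum>i<m. d i) + (\<Sum>i<k. s i - c)"
  proof -
    have "{..<m} \<inter> {i. i < k} = {..<k}" using k by auto
    then show ?thesis
      by (simp add: sum.distrib sum_distrib_left sum.If_cases)
  qed
  also have "\<dots> \<le> c * real k + (\<Sum>i<k. s i - c)"
    using d(3) s(1)[of "k - 1"] k by (auto simp: c_def intro: mult_left_mono)
  finally show ?thesis
    by (simp add: sum_subtractf)
qed

lemma diag_mat_col:
  fixes f :: "nat \<Rightarrow> real"
  assumes "j < m" "m \<le> n"
  shows "col (mat n m (\<lambda>(i, j). if i = j then f j else 0)) j = f j \<cdot>\<^sub>v unit_vec n j"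
  using assms by (intro eq_vecI) auto

text \<open>
  The Ky Fan bound for a diagonal matrix.  Column \<open>j\<close> of the product is \<open>s j\<close> times row \<open>j\<close> of
  \<open>P\<close>, so the squared Frobenius norm is a weighted sum of the \<open>(s j)\<^sup>2\<close>.  The weights are squared row
  norms of \<open>P\<close>: at most 1 by Bessel, and of total mass \<open>k\<close> because \<open>P\<close> has \<open>k\<close> unit columns.
\<close>

lemma frobenius_ky_fan:
  assumes P: "P \<in> carrier_mat n k" "orthonormal_cols P" and k: "1 \<le> k" "k \<le> m" "m \<le> n"
    and s: "\<And>i. i < m \<Longrightarrow> 0 \<le> s i" "\<And>i j. i \<le> j \<Longrightarrow> j < m \<Longrightarrow> s j \<le> s i"
  shows "(frobenius_norm (P\<^sup>T * mat n m (\<lambda>(i, j). if i = j then s j else 0)))\<^sup>2 \<le> (\<Sum>i<k. (s i)\<^sup>2)"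
proof -
  define d where "d i = (norm2 (row P i))\<^sup>2" for i
  let ?S = "mat n m (\<lambda>(i, j). if i = j then s j else 0)"
  have S: "?S \<in> carrier_mat n m" by simp
  have P': "P\<^sup>T \<in> carrier_mat k n" using P by simp
  have rowP: "P\<^sup>T *\<^sub>v unit_vec n i = row P i" if "i < n" for i
    using mult_unit_vec[OF P' that] P that by simp
  have "d i \<le> 1" if "i < n" for i
    using bessel_inequality[OF P, of "unit_vec n i"] that rowP[OF that] by (simp add: d_def norm2_unit)
  moreover have "(\<Sum>i<m. d i) \<le> real k"
  proof -
    have "(\<Sum>i<m. d i) \<le> (\<Sum>i<n. d i)"
      using k by (intro sum_mono2) (auto simp: d_def)
    also have "\<dots> = (frobenius_norm P)\<^sup>2"
      using P by (simp add: frobenius_sq_rows d_def)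
    also have "\<dots> = (\<Sum>j<k. 1)"
      unfolding frobenius_sq_cols using P orthonormal_cols_col_prod[OF P(2)]
      by (intro sum.cong) (auto simp: norm2_sq)
    finally show ?thesis by simp
  qed
  ultimately have "(\<Sum>i<m. (s i)\<^sup>2 * d i) \<le> (\<Sum>i<k. (s i)\<^sup>2)"
    using k s by (intro weighted_sum_le_top) (auto simp: d_def intro: power_mono)
  moreover have "(norm2 (col (P\<^sup>T * ?S) j))\<^sup>2 = (s j)\<^sup>2 * d j" if "j < m" for j
  proof -
    have "col (P\<^sup>T * ?S) j = s j \<cdot>\<^sub>v row P j"
      unfolding col_mult2[OF P' S that] diag_mat_col[OF that k(3)]
      using that k P' by (simp add: mult_mat_vec[OF P'] rowP)
    then show ?thesis
      by (simp add: norm2_smult_sq d_def)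
  qed
  ultimately show ?thesis
    by (simp add: frobenius_sq_cols)
qed

lemma is_svdD:
  assumes svd: "is_svd B \<Psi> \<sigma> \<Phi>" and B: "B \<in> carrier_mat n m" and mn: "m \<le> n"
  shows "\<Psi> \<in> carrier_mat n n" "orthonormal_cols \<Psi>" "\<Phi> \<in> carrier_mat m m" "orthonormal_cols \<Phi>"
    and "\<And>i. i < m \<Longrightarrow> 0 \<le> \<sigma> (i + 1)" "\<And>i j. i \<le> j \<Longrightarrow> j < m \<Longrightarrow> \<sigma> (j + 1) \<le> \<sigma> (i + 1)"
    and "B = \<Psi> * (mat n m (\<lambda>(i, j). if i = j then \<sigma> (j + 1) else 0) * \<Phi>\<^sup>T)"
proof -
  have dims: "dim_row B = n" "dim_col B = m" "min n m = m"
    using B mn by auto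
  show P: "\<Psi> \<in> carrier_mat n n" "orthonormal_cols \<Psi>" "\<Phi> \<in> carrier_mat m m" "orthonormal_cols \<Phi>"
    using svd unfolding is_svd_def real_orthogonal_mat_def dims by auto
  show "\<And>i. i < m \<Longrightarrow> 0 \<le> \<sigma> (i + 1)" "\<And>i j. i \<le> j \<Longrightarrow> j < m \<Longrightarrow> \<sigma> (j + 1) \<le> \<sigma> (i + 1)"
    using svd unfolding is_svd_def dims by auto
  have "B = \<Psi> * mat n m (\<lambda>(i, j). if i = j then \<sigma> (j + 1) else 0) * \<Phi>\<^sup>T"
    using svd unfolding is_svd_def dims by (elim conjE)
  also have "\<dots> = \<Psi> * (mat n m (\<lambda>(i, j). if i = j then \<sigma> (j + 1) else 0) * \<Phi>\<^sup>T)"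
    using P by (intro assoc_mult_mat[of _ n n _ m _ m]) auto
  finally show "B = \<Psi> * (mat n m (\<lambda>(i, j). if i = j then \<sigma> (j + 1) else 0) * \<Phi>\<^sup>T)" .
qed

text \<open>
  The general Ky Fan bound reduces to the diagonal one, since both orthogonal factors are invisible
  to the Frobenius norm: \<open>\<Psi>\<close> turns \<open>S\<close> into another orthonormal family, and \<open>\<Phi>\<close> acts from the right.
\<close>

lemma frobenius_svd_le:
  assumes svd: "is_svd B \<Psi> \<sigma> \<Phi>" and B: "B \<in> carrier_mat n m" and mn: "m \<le> n"
    and S: "S \<in> carrier_mat n k" "orthonormal_cols S" and k: "1 \<le> k" "k \<le> m"
  shows "(frobenius_norm (S\<^sup>T * B))\<^sup>2 \<le> (\<Sum>i<k. (\<sigma> (i + 1))\<^sup>2)"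
proof -
  note svdD = is_svdD[OF svd B mn]
  let ?D = "mat n m (\<lambda>(i, j). if i = j then \<sigma> (j + 1) else 0)"
  define P where "P = \<Psi>\<^sup>T * S"
  have P: "P \<in> carrier_mat n k" "orthonormal_cols P"
    using svdD(1) S orthonormal_cols_transpose[OF svdD(1,2)]
    by (auto simp: P_def intro!: orthonormal_cols_mult[of _ n n _ k])
  have D: "?D \<in> carrier_mat n m" and St: "S\<^sup>T \<in> carrier_mat k n" and Pht: "\<Phi>\<^sup>T \<in> carrier_mat m m"
    using S svdD(3) by auto
  have "S\<^sup>T * B = S\<^sup>T * \<Psi> * (?D * \<Phi>\<^sup>T)"
    unfolding svdD(7) by (rule assoc_mult_mat[OF St svdD(1) mult_carrier_mat[OF D Pht], symmetric])
  also have "S\<^sup>T * \<Psi> = P\<^sup>T"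
    unfolding P_def using S(1) svdD(1) by (subst transpose_mult[of _ n n _ k]) auto
  also have "P\<^sup>T * (?D * \<Phi>\<^sup>T) = P\<^sup>T * ?D * \<Phi>\<^sup>T"
    using P(1) by (intro assoc_mult_mat[OF _ D Pht, symmetric]) auto
  finally have "(frobenius_norm (S\<^sup>T * B))\<^sup>2 = (frobenius_norm (P\<^sup>T * ?D))\<^sup>2"
    using P(1) D frobenius_mult_orthogonal[OF Pht orthonormal_cols_transpose[OF svdD(3,4)], of "P\<^sup>T * ?D" k]
    by simp
  also have "\<dots> \<le> (\<Sum>i<k. (\<sigma> (i + 1))\<^sup>2)"
    using svdD(5,6) by (intro frobenius_ky_fan[OF P k mn]) auto
  finally show ?thesis .
qed

text \<open>
  Here the Ky Fan bound is attained: the map \<open>B\<close> stretches the \<open>i\<close>-th right singular vector by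
  exactly the factor \<open>\<sigma> i\<close>.
\<close>

lemma frobenius_leading_right_singular:
  assumes svd: "is_svd B \<Psi> \<sigma> \<Phi>" and B: "B \<in> carrier_mat n m" and mn: "m \<le> n" and c: "c \<le> m"
  shows "(frobenius_norm (B * mat_of_cols m (take c (cols \<Phi>))))\<^sup>2 = (\<Sum>i<c. (\<sigma> (i + 1))\<^sup>2)"
proof -
  note svdD = is_svdD[OF svd B mn]
  let ?D = "mat n m (\<lambda>(i, j). if i = j then \<sigma> (j + 1) else 0)"
  let ?F = "mat_of_cols m (take c (cols \<Phi>))"
  have D: "?D \<in> carrier_mat n m" and Pht: "\<Phi>\<^sup>T \<in> carrier_mat m m"
    using svdD(3) by auto
  have F: "?F \<in> carrier_mat m c"
    using c svdD(3) by (intro carrier_matI) auto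
  have "(norm2 (col (B * ?F) j))\<^sup>2 = (\<sigma> (j + 1))\<^sup>2" if j: "j < c" for j
  proof -
    have jm: "j < m" using j c by simp
    have colF: "col ?F j = col \<Phi> j"
      using j c svdD(3) by (subst col_mat_of_cols) auto
    have col: "col \<Phi> j \<in> carrier_vec m"
      using svdD(3) by auto
    have "\<Phi>\<^sup>T *\<^sub>v col \<Phi> j = col (1\<^sub>m m) j"
      unfolding col_mult2[OF Pht svdD(3) jm, symmetric] orthonormal_colsD[OF svdD(4,3)] ..
    then have e: "\<Phi>\<^sup>T *\<^sub>v col \<Phi> j = unit_vec m j"
      using jm by simp
    have "col (B * ?F) j = B *\<^sub>v col \<Phi> j"
      by (simp only: col_mult2[OF B F j] colF)
    also have "\<dots> = \<Psi> *\<^sub>v (?D *\<^sub>v unit_vec m j)"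
      unfolding svdD(7) e[symmetric]
      using assoc_mult_mat_vec[OF svdD(1) mult_carrier_mat[OF D Pht] col] assoc_mult_mat_vec[OF D Pht col]
      by simp
    also have "?D *\<^sub>v unit_vec m j = \<sigma> (j + 1) \<cdot>\<^sub>v unit_vec n j"
      unfolding mult_unit_vec[OF D jm] by (rule diag_mat_col[OF jm mn])
    finally show ?thesis
      using norm2_orthonormal_mult[OF svdD(1,2), of "\<sigma> (j + 1) \<cdot>\<^sub>v unit_vec n j"] jm mn
      by (simp add: norm2_smult_sq norm2_unit)
  qed
  then show ?thesis
    using c carrier_matD(2)[OF svdD(3)] by (simp add: frobenius_sq_cols min_absorb2)
qed

section \<open>Tikhonov minimizers and the residual of an enlarged problem\<close>

text \<open>
  First-order optimality, obtained without calculus.  Let \<open>h\<close> be the residual of the normal equations.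
  Along the line \<open>y + t h\<close> the objective is a quadratic polynomial in \<open>t\<close> with slope
  \<open>- 2 \<parallel>h\<parallel>\<^sup>2\<close> at 0, so a nonzero \<open>h\<close> would be a direction of descent.
\<close>

lemma tikhonov_normal_equations:
  assumes B: "B \<in> carrier_mat r n" and g: "g \<in> carrier_vec r"
    and y: "is_arg_min (\<lambda>w. (norm2 (B *\<^sub>v w - g))\<^sup>2 + c\<^sup>2 * (norm2 w)\<^sup>2) (\<lambda>w. w \<in> carrier_vec n) y"
  shows "B\<^sup>T *\<^sub>v (g - B *\<^sub>v y) - c\<^sup>2 \<cdot>\<^sub>v y = 0\<^sub>v n"
proof -
  define h where "h = B\<^sup>T *\<^sub>v (g - B *\<^sub>v y) - c\<^sup>2 \<cdot>\<^sub>v y"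
  define q where "q = (norm2 (B *\<^sub>v h))\<^sup>2 + c\<^sup>2 * (norm2 h)\<^sup>2"
  define s where "s = (norm2 h)\<^sup>2"
  define e where "e = B *\<^sub>v y - g"
  have yc: "y \<in> carrier_vec n"
    and ymin: "w \<in> carrier_vec n \<Longrightarrow> (norm2 e)\<^sup>2 + c\<^sup>2 * (norm2 y)\<^sup>2
      \<le> (norm2 (B *\<^sub>v w - g))\<^sup>2 + c\<^sup>2 * (norm2 w)\<^sup>2" for w
    using y unfolding is_arg_min_linorder e_def by auto
  have hc: "h \<in> carrier_vec n" and Bh: "B *\<^sub>v h \<in> carrier_vec r" and By: "B *\<^sub>v y \<in> carrier_vec r"
    and ec: "e \<in> carrier_vec r"
    using B g yc by (auto simp: h_def e_def)
  have expand: "(norm2 (a + t \<cdot>\<^sub>v z))\<^sup>2 = (norm2 a)\<^sup>2 + 2 * t * (a \<bullet> z) + t\<^sup>2 * (norm2 z)\<^sup>2"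
    if "a \<in> carrier_vec i" "z \<in> carrier_vec i" for a z t i
    unfolding norm2_sq using that comm_scalar_prod[OF that]
    by (simp add: add_scalar_prod_distrib[of _ i] scalar_prod_add_distrib[of _ i]
        power2_eq_square algebra_simps)
  have slope: "e \<bullet> (B *\<^sub>v h) + c\<^sup>2 * (y \<bullet> h) = - s"
  proof -
    have BT: "B\<^sup>T *\<^sub>v (g - B *\<^sub>v y) \<in> carrier_vec n"
      using B g By by (intro mult_mat_vec_carrier[of _ n r]) auto
    have "s = (B\<^sup>T *\<^sub>v (g - B *\<^sub>v y) - c\<^sup>2 \<cdot>\<^sub>v y) \<bullet> h"
      by (simp add: s_def norm2_sq h_def)
    also have "\<dots> = (B\<^sup>T *\<^sub>v (g - B *\<^sub>v y)) \<bullet> h - c\<^sup>2 * (y \<bullet> h)"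
      using yc hc BT minus_scalar_prod_distrib[of _ n "c\<^sup>2 \<cdot>\<^sub>v y" h] by simp
    also have "(B\<^sup>T *\<^sub>v (g - B *\<^sub>v y)) \<bullet> h = (g - B *\<^sub>v y) \<bullet> (B *\<^sub>v h)"
      using B g By hc by (intro transpose_vec_mult_scalar) auto
    also have "\<dots> = - (e \<bullet> (B *\<^sub>v h))"
      using g By Bh by (simp add: e_def minus_scalar_prod_distrib[of _ r])
    finally show ?thesis by simp
  qed
  have ineq: "0 \<le> - 2 * t * s + t\<^sup>2 * q" for t
  proof -
    have "B *\<^sub>v (y + t \<cdot>\<^sub>v h) - g = e + t \<cdot>\<^sub>v (B *\<^sub>v h)"
      using B g yc hc Bh By unfolding e_def
      by (simp add: mult_add_distrib_mat_vec[of _ r n] mult_mat_vec[of _ r n])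
        (intro eq_vecI, auto)
    moreover have "(norm2 e)\<^sup>2 + c\<^sup>2 * (norm2 y)\<^sup>2
      \<le> (norm2 (B *\<^sub>v (y + t \<cdot>\<^sub>v h) - g))\<^sup>2 + c\<^sup>2 * (norm2 (y + t \<cdot>\<^sub>v h))\<^sup>2"
      using yc hc by (intro ymin) auto
    ultimately have "0 \<le> 2 * t * (e \<bullet> (B *\<^sub>v h) + c\<^sup>2 * (y \<bullet> h)) + t\<^sup>2 * q"
      by (simp add: expand[OF ec Bh] expand[OF yc hc] q_def algebra_simps)
    then show ?thesis
      by (simp add: slope)
  qed
  have "s = 0"
  proof (rule ccontr)
    assume "s \<noteq> 0"
    then have s: "0 < s" by (simp add: s_def)
    have q: "0 \<le> q" by (simp add: q_def)
    \<comment> \<open>The step \<open>s / (q + 1)\<close> along \<open>h\<close> is short enough to decrease the objective.\<close>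
    have "(s / (q + 1)) * q < s"
      using s q by (simp add: field_simps)
    then have "(s / (q + 1)) * ((s / (q + 1)) * q - 2 * s) < 0"
      using s q by (intro mult_pos_neg) auto
    then show False
      using ineq[of "s / (q + 1)"] by (simp add: power2_eq_square algebra_simps)
  qed
  then show ?thesis
    using norm2_eq_zero[OF _ hc] by (simp add: s_def h_def)
qed

text \<open>
  The core of the argument.  Because \<open>A P1 = Q1 H\<close>, the full matrix is block upper triangular,
  \<open>G = [H C; 0 D]\<close> with \<open>C = Q1\<^sup>T A P2\<close>, and the data has no component along \<open>Q2\<close>.  Hence the
  data residual of the padded vector \<open>[y; 0]\<close> is the small residual \<open>e = g - H y\<close> padded by zeros, and
  the residual of the normal equations is \<open>[H\<^sup>T e - c\<^sup>2 y; C\<^sup>T e]\<close>.  The first block vanishes because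
  \<open>y\<close> solves the small problem.  What remains is \<open>C\<^sup>T e\<close>.
\<close>

lemma full_residual_le:
  assumes A: "A \<in> carrier_mat M N"
    and Q1: "Q1 \<in> carrier_mat M r" and Q2: "Q2 \<in> carrier_mat M q" and Q: "orthonormal_cols (Q1 @\<^sub>c Q2)"
    and P1: "P1 \<in> carrier_mat N s" and P2: "P2 \<in> carrier_mat N t"
    and H: "H \<in> carrier_mat r s" and AP: "A * P1 = Q1 * H"
    and g: "g \<in> carrier_vec r"
    and y: "is_arg_min (\<lambda>w. (norm2 (H *\<^sub>v w - g))\<^sup>2 + c\<^sup>2 * (norm2 w)\<^sup>2) (\<lambda>w. w \<in> carrier_vec s) y"
    and G: "G = (Q1 @\<^sub>c Q2)\<^sup>T * (A * (P1 @\<^sub>c P2))"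
    and f: "f = (Q1 @\<^sub>c Q2)\<^sup>T *\<^sub>v (Q1 *\<^sub>v g)"
  shows "(norm2 (G\<^sup>T *\<^sub>v f - (G\<^sup>T * G + c\<^sup>2 \<cdot>\<^sub>m 1\<^sub>m (s + t)) *\<^sub>v (y @\<^sub>v 0\<^sub>v t)))\<^sup>2
    \<le> (norm2 (g - H *\<^sub>v y))\<^sup>2 * (frobenius_norm (Q1\<^sup>T * (A * P2)))\<^sup>2"
proof -
  define e where "e = g - H *\<^sub>v y"
  define C where "C = Q1\<^sup>T * (A * P2)"
  define D where "D = Q2\<^sup>T * (A * P2)"
  define y0 where "y0 = y @\<^sub>v (0\<^sub>v t :: real vec)"
  note orth = append_cols_orthonormalD[OF Q1 Q2 Q]
  have yc: "y \<in> carrier_vec s"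
    using y by (simp add: is_arg_min_def)
  have c: "C \<in> carrier_mat r t" "D \<in> carrier_mat q t" "Q1\<^sup>T \<in> carrier_mat r M" "Q2\<^sup>T \<in> carrier_mat q M"
    using A Q1 Q2 P2 by (auto simp: C_def D_def)
  have Hy: "H *\<^sub>v y \<in> carrier_vec r" and ec: "e \<in> carrier_vec r" and y0: "y0 \<in> carrier_vec (s + t)"
    using H yc g by (auto simp: e_def y0_def)
  have Qc: "(Q1 @\<^sub>c Q2)\<^sup>T \<in> carrier_mat (r + q) M"
    using append_cols_carrier[OF Q1 Q2] by simp
  have G_eq: "G = four_block_mat H C (0\<^sub>m q s) D"
  proof -
    have AP1: "A * P1 \<in> carrier_mat M s" and AP2: "A * P2 \<in> carrier_mat M t"
      using A P1 P2 by auto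
    have "Q1\<^sup>T * (A * P1) = H"
      unfolding AP assoc_mult_mat[OF c(3) Q1 H, symmetric] orthonormal_colsD[OF orth(1) Q1]
      using H by simp
    moreover have "Q2\<^sup>T * (A * P1) = 0\<^sub>m q s"
      unfolding AP assoc_mult_mat[OF c(4) Q1 H, symmetric] orth(4) using H by simp
    ultimately show ?thesis
      unfolding G mult_append_cols[OF A P1 P2] C_def D_def
      by (simp only: transpose_append_cols_mult_append_cols[OF Q1 Q2 AP1 AP2])
  qed
  have Gc: "G \<in> carrier_mat (r + q) (s + t)"
    unfolding G_eq by (rule four_block_carrier_mat[OF H c(2)])
  have Gt: "G\<^sup>T \<in> carrier_mat (s + t) (r + q)"
    using Gc by simp
  have f_eq: "f = g @\<^sub>v 0\<^sub>v q"
  proof -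
    have Qg: "Q1 *\<^sub>v g \<in> carrier_vec M"
      using Q1 g by auto
    have "Q1\<^sup>T *\<^sub>v (Q1 *\<^sub>v g) = g"
      unfolding assoc_mult_mat_vec[OF c(3) Q1 g, symmetric] orthonormal_colsD[OF orth(1) Q1]
      using g by simp
    moreover have "Q2\<^sup>T *\<^sub>v (Q1 *\<^sub>v g) = 0\<^sub>v q"
      unfolding assoc_mult_mat_vec[OF c(4) Q1 g, symmetric] orth(4)
      using g by (intro eq_vecI) auto
    ultimately show ?thesis
      unfolding f transpose_append_cols_mult_vec[OF Q1 Q2 Qg] by simp
  qed
  have Gy: "G *\<^sub>v y0 = H *\<^sub>v y @\<^sub>v 0\<^sub>v q"
    unfolding G_eq y0_def four_block_mat_mult_vec[OF H c(1) zero_carrier_mat c(2) yc zero_carrier_vec]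
    using H c yc by (intro arg_cong2[of _ _ _ _ "(@\<^sub>v)"] eq_vecI) auto
  have fc: "f \<in> carrier_vec (r + q)" and Gyc: "G *\<^sub>v y0 \<in> carrier_vec (r + q)"
    using g Gc y0 by (auto simp: f_eq)
  have res: "f - G *\<^sub>v y0 = e @\<^sub>v 0\<^sub>v q"
    unfolding f_eq Gy e_def using carrier_vecD[OF g] carrier_matD(1)[OF H] by (intro eq_vecI) auto
  have Ge: "G\<^sup>T *\<^sub>v (e @\<^sub>v 0\<^sub>v q) = H\<^sup>T *\<^sub>v e @\<^sub>v C\<^sup>T *\<^sub>v e"
  proof -
    have t: "H\<^sup>T \<in> carrier_mat s r" "C\<^sup>T \<in> carrier_mat t r" "D\<^sup>T \<in> carrier_mat t q"
      "(0\<^sub>m q s)\<^sup>T \<in> carrier_mat s q"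
      using H c by auto
    show ?thesis
      unfolding G_eq transpose_four_block_mat[OF H c(1) zero_carrier_mat c(2)]
        four_block_mat_mult_vec[OF t(1,4,2,3) ec zero_carrier_vec]
      using t ec by (intro arg_cong2[of _ _ _ _ "(@\<^sub>v)"] eq_vecI) auto
  qed
  have "G\<^sup>T *\<^sub>v f - (G\<^sup>T * G + c\<^sup>2 \<cdot>\<^sub>m 1\<^sub>m (s + t)) *\<^sub>v y0 = G\<^sup>T *\<^sub>v (f - G *\<^sub>v y0) - c\<^sup>2 \<cdot>\<^sub>v y0"
  proof -
    have "(c\<^sup>2 \<cdot>\<^sub>m 1\<^sub>m (s + t)) *\<^sub>v y0 = c\<^sup>2 \<cdot>\<^sub>v y0"
      using y0 by (intro eq_vecI) (auto simp: smult_scalar_prod_distrib)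
    then have "(G\<^sup>T * G + c\<^sup>2 \<cdot>\<^sub>m 1\<^sub>m (s + t)) *\<^sub>v y0 = G\<^sup>T *\<^sub>v (G *\<^sub>v y0) + c\<^sup>2 \<cdot>\<^sub>v y0"
      using add_mult_distrib_mat_vec[OF mult_carrier_mat[OF Gt Gc], of "c\<^sup>2 \<cdot>\<^sub>m 1\<^sub>m (s + t)" y0] y0
        assoc_mult_mat_vec[OF Gt Gc y0] by simp
    moreover have "a - (b + d) = a - b - d"
      if "a \<in> carrier_vec (s + t)" "b \<in> carrier_vec (s + t)" "d \<in> carrier_vec (s + t)" for a b d :: "real vec"
      using that by (intro eq_vecI) auto
    ultimately show ?thesis
      using mult_mat_vec_carrier[OF Gt fc] mult_mat_vec_carrier[OF Gt Gyc] y0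
      unfolding mult_minus_distrib_mat_vec[OF Gt fc Gyc] by simp
  qed
  also have "\<dots> = (H\<^sup>T *\<^sub>v e - c\<^sup>2 \<cdot>\<^sub>v y) @\<^sub>v C\<^sup>T *\<^sub>v e"
    unfolding res Ge unfolding y0_def using H c yc ec by (intro eq_vecI) auto
  also have "H\<^sup>T *\<^sub>v e - c\<^sup>2 \<cdot>\<^sub>v y = 0\<^sub>v s"
    unfolding e_def by (rule tikhonov_normal_equations[OF H g y])
  finally have "(norm2 (G\<^sup>T *\<^sub>v f - (G\<^sup>T * G + c\<^sup>2 \<cdot>\<^sub>m 1\<^sub>m (s + t)) *\<^sub>v y0))\<^sup>2 = (norm2 (C\<^sup>T *\<^sub>v e))\<^sup>2"
    by (simp add: norm2_append_sq norm2_zero)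
  also have "\<dots> \<le> (frobenius_norm C\<^sup>T)\<^sup>2 * (norm2 e)\<^sup>2"
    using c ec by (intro norm2_mult_mat_vec_sq_le) auto
  finally show ?thesis
    unfolding y0_def e_def C_def frobenius_transpose by (simp add: mult.commute)
qed

section \<open>Golub-Kahan bidiagonalization\<close>

lemma cols_upto_carrier: "cols_upto d v n \<in> carrier_mat d n"
  unfolding cols_upto_def by (rule carrier_matI) simp_all

lemma col_cols_upto:
  assumes "j < n" "v (j + 1) \<in> carrier_vec d"
  shows "col (cols_upto d v n) j = v (j + 1)"
proof -
  have "map v [1..<n+1] ! j = v (j + 1)"
    using assms by (simp del: upt_Suc)
  then show ?thesis
    unfolding cols_upto_def using assms by (subst col_mat_of_cols) (auto simp del: upt_Suc)
qed

lemma cols_upto_mult_unit_vec: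
  assumes "j < n" "v (j + 1) \<in> carrier_vec d"
  shows "cols_upto d v n *\<^sub>v unit_vec n j = v (j + 1)"
  using mult_unit_vec[OF cols_upto_carrier assms(1)] col_cols_upto[of j n v d, OF assms] by (rule trans)

lemma bidiag_carrier: "bidiag \<alpha> \<beta> n \<in> carrier_mat (n + 1) n"
  by (simp add: bidiag_def)

lemma col_bidiag:
  assumes "j < n"
  shows "col (bidiag \<alpha> \<beta> n) j =
    \<alpha> (j + 1) \<cdot>\<^sub>v unit_vec (n + 1) j + \<beta> (j + 2) \<cdot>\<^sub>v unit_vec (n + 1) (j + 1)"
  using assms by (intro eq_vecI) (auto simp: bidiag_def)

text \<open>
  The passage from a two-term vector recurrence to a matrix identity.  It is stated for an arbitrary
  operator \<open>X\<close>, because the recycling process runs on the projected operator \<open>(1 - Y Y\<^sup>T) A\<close> and not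
  on \<open>A\<close>.
\<close>

lemma bidiag_relation:
  assumes X: "X \<in> carrier_mat M N"
    and v: "\<And>j. j \<in> {1..n} \<Longrightarrow> v j \<in> carrier_vec N"
    and u: "\<And>j. j \<in> {1..n + 1} \<Longrightarrow> u j \<in> carrier_vec M"
    and rec: "\<And>j. j \<in> {1..n} \<Longrightarrow> X *\<^sub>v v j = \<alpha> j \<cdot>\<^sub>v u j + \<beta> (j + 1) \<cdot>\<^sub>v u (j + 1)"
  shows "X * cols_upto N v n = cols_upto M u (n + 1) * bidiag \<alpha> \<beta> n"
proof (rule mat_col_eqI)
  note V = cols_upto_carrier[of N v n] and U = cols_upto_carrier[of M u "n + 1"]
    and B = bidiag_carrier[of \<alpha> \<beta> n]
  fix j assume "j < dim_col (cols_upto M u (n + 1) * bidiag \<alpha> \<beta> n)"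
  then have j: "j < n"
    by (simp only: index_mult_mat carrier_matD[OF B])
  then have mem: "j + 1 \<in> {1..n}" "j + 1 \<in> {1..n + 1}" "j + 1 + 1 \<in> {1..n + 1}"
    and lt: "j < n + 1" "j + 1 < n + 1" and two: "j + 2 = j + 1 + 1"
    by auto
  let ?e = "unit_vec (n + 1) :: nat \<Rightarrow> real vec"
  have e: "\<alpha> (j + 1) \<cdot>\<^sub>v ?e j \<in> carrier_vec (n + 1)"
    "\<beta> (j + 1 + 1) \<cdot>\<^sub>v ?e (j + 1) \<in> carrier_vec (n + 1)"
    by simp_all
  have "col (X * cols_upto N v n) j = X *\<^sub>v v (j + 1)"
    by (simp only: col_mult2[OF X V j] col_cols_upto[of j n v N, OF j v[OF mem(1)]])
  also have "\<dots> = \<alpha> (j + 1) \<cdot>\<^sub>v u (j + 1) + \<beta> (j + 1 + 1) \<cdot>\<^sub>v u (j + 1 + 1)"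
    by (rule rec[OF mem(1)])
  also have "\<dots> = cols_upto M u (n + 1) *\<^sub>v col (bidiag \<alpha> \<beta> n) j"
    unfolding col_bidiag[OF j] two mult_add_distrib_mat_vec[OF U e]
      mult_mat_vec[OF U unit_vec_carrier]
      cols_upto_mult_unit_vec[of j "n + 1" u M, OF lt(1) u[OF mem(2)]]
      cols_upto_mult_unit_vec[of "j + 1" "n + 1" u M, OF lt(2) u[OF mem(3)]] ..
  also have "\<dots> = col (cols_upto M u (n + 1) * bidiag \<alpha> \<beta> n) j"
    by (rule col_mult2[OF U B j, symmetric])
  finally show "col (X * cols_upto N v n) j = col (cols_upto M u (n + 1) * bidiag \<alpha> \<beta> n) j" .
qed (simp_all only: index_mult_mat carrier_matD[OF X] carrier_matD[OF cols_upto_carrier]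
    carrier_matD[OF bidiag_carrier])

text \<open>
  Forward substitution: row \<open>i\<close> of a lower bidiagonal system contains, besides an entry of \<open>z\<close> already
  known to vanish, only \<open>\<alpha> (i + 1) * z i\<close>.
\<close>

lemma bidiag_mult_vec_eq_zero:
  assumes \<alpha>: "\<And>j. j \<in> {1..n} \<Longrightarrow> \<alpha> j \<noteq> 0" and z: "z \<in> carrier_vec n"
    and Bz: "bidiag \<alpha> \<beta> n *\<^sub>v z = 0\<^sub>v (n + 1)"
  shows "z = 0\<^sub>v n"
proof -
  have "z $ i = 0" if "i < n" for i
    using that
  proof (induction i rule: less_induct)
    case (less i)
    have "0 = (bidiag \<alpha> \<beta> n *\<^sub>v z) $ i"
      using Bz less.prems by simp
    also have "\<dots> = (\<Sum>j<n. bidiag \<alpha> \<beta> n $$ (i, j) * z $ j)"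
      using less.prems z bidiag_carrier[of \<alpha> \<beta> n]
      by (simp add: scalar_prod_def lessThan_atLeast0)
    also have "\<dots> = (\<Sum>j<n. if j = i then \<alpha> (i + 1) * z $ i else 0)"
      using less by (intro sum.cong) (auto simp: bidiag_def)
    finally have "\<alpha> (i + 1) * z $ i = 0"
      using less.prems by simp
    then show ?case
      using \<alpha>[of "i + 1"] less.prems by simp
  qed
  then show ?thesis
    using z by (intro eq_vecI) auto
qed

lemma eq_add_of_eq_minus:
  fixes x y z :: "'a :: ring vec"
  assumes "x = y - z" "y \<in> carrier_vec n" "z \<in> carrier_vec n"
  shows "y = x + z"
  using assms by (intro eq_vecI) auto

lemma gkb_vectors:
  assumes gkb: "gkb A b n \<alpha> \<beta> u v" and A: "A \<in> carrier_mat M N"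
  shows "\<And>j. j \<in> {1..n + 1} \<Longrightarrow> u j \<in> carrier_vec M \<and> u j \<bullet> u j = 1 \<and> 0 < \<beta> j"
    and "\<And>j. j \<in> {1..n} \<Longrightarrow> v j \<in> carrier_vec N \<and> v j \<bullet> v j = 1 \<and> 0 < \<alpha> j"
proof -
  have "\<forall>j\<in>{1..n + 1}. u j \<in> carrier_vec (dim_row A) \<and> norm2 (u j) = 1 \<and> 0 < \<beta> j"
    using gkb unfolding gkb_def by (elim conjE)
  then show "u j \<in> carrier_vec M \<and> u j \<bullet> u j = 1 \<and> 0 < \<beta> j" if "j \<in> {1..n + 1}" for j
    using A that norm2_sq[of "u j"] by auto
  have "\<forall>j\<in>{1..n}. v j \<in> carrier_vec (dim_col A) \<and> norm2 (v j) = 1 \<and> 0 < \<alpha> j"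
    using gkb unfolding gkb_def by (elim conjE)
  then show "v j \<in> carrier_vec N \<and> v j \<bullet> v j = 1 \<and> 0 < \<alpha> j" if "j \<in> {1..n}" for j
    using A that norm2_sq[of "v j"] by auto
qed

lemma gkb_carrier:
  assumes "gkb A b n \<alpha> \<beta> u v" "A \<in> carrier_mat M N"
  shows "\<And>j. j \<in> {1..n + 1} \<Longrightarrow> u j \<in> carrier_vec M" "\<And>j. j \<in> {1..n} \<Longrightarrow> v j \<in> carrier_vec N"
  using gkb_vectors[OF assms] by blast+

lemma gkb_mult_v:
  assumes gkb: "gkb A b n \<alpha> \<beta> u v" and A: "A \<in> carrier_mat M N" and j: "j \<in> {1..n}"
  shows "A *\<^sub>v v j = \<alpha> j \<cdot>\<^sub>v u j + \<beta> (j + 1) \<cdot>\<^sub>v u (j + 1)"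
proof -
  note c = gkb_carrier[OF gkb A]
  have "\<beta> (j + 1) \<cdot>\<^sub>v u (j + 1) = A *\<^sub>v v j - \<alpha> j \<cdot>\<^sub>v u j"
    using gkb j unfolding gkb_def by blast
  then have "A *\<^sub>v v j = \<beta> (j + 1) \<cdot>\<^sub>v u (j + 1) + \<alpha> j \<cdot>\<^sub>v u j"
    using c j A by (intro eq_add_of_eq_minus[of _ _ _ M]) auto
  also have "\<dots> = \<alpha> j \<cdot>\<^sub>v u j + \<beta> (j + 1) \<cdot>\<^sub>v u (j + 1)"
    using c j by (intro comm_add_vec[of _ M]) auto
  finally show ?thesis .
qed

lemma gkb_transpose_mult_u:
  assumes gkb: "gkb A b n \<alpha> \<beta> u v" and A: "A \<in> carrier_mat M N" and j: "j \<in> {1..<n}"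
  shows "A\<^sup>T *\<^sub>v u (j + 1) = \<alpha> (j + 1) \<cdot>\<^sub>v v (j + 1) + \<beta> (j + 1) \<cdot>\<^sub>v v j"
proof -
  note c = gkb_carrier[OF gkb A]
  have "\<alpha> (j + 1) \<cdot>\<^sub>v v (j + 1) = A\<^sup>T *\<^sub>v u (j + 1) - \<beta> (j + 1) \<cdot>\<^sub>v v j"
    using gkb j unfolding gkb_def by blast
  then show ?thesis
    using c j A by (intro eq_add_of_eq_minus[of _ _ _ N]) auto
qed

text \<open>
  The two families are made orthonormal in turn.  To test \<open>v (J + 1)\<close> against an earlier \<open>v i\<close>, move
  \<open>A\<^sup>T\<close> to the other side and expand \<open>A v i\<close> in \<open>u i\<close> and \<open>u (i + 1)\<close>.  Only \<open>i = J\<close> contributes,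
  and that contribution is the term \<open>\<beta> (J + 1)\<close> which the recurrence subtracts.  The test of
  \<open>u (J + 2)\<close> against \<open>u i\<close> is the mirror image, with \<open>\<alpha> (J + 1)\<close> as the cancelling term.
\<close>

lemma gkb_orthonormal_vectors:
  assumes gkb: "gkb A b n \<alpha> \<beta> u v" and A: "A \<in> carrier_mat M N"
  shows "J \<le> n \<Longrightarrow>
    (\<forall>i\<in>{1..J + 1}. \<forall>j\<in>{1..J + 1}. u i \<bullet> u j = (if i = j then 1 else 0)) \<and>
    (\<forall>i\<in>{1..J}. \<forall>j\<in>{1..J}. v i \<bullet> v j = (if i = j then 1 else 0))"
proof (induction J)
  case 0
  then show ?case using gkb_vectors(1)[OF gkb A, of 1] by auto
next
  case (Suc J)
  note uc = gkb_carrier(1)[OF gkb A] and vc = gkb_carrier(2)[OF gkb A]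
  have uu: "u j \<bullet> u j = 1" if "j \<in> {1..n + 1}" for j
    using gkb_vectors(1)[OF gkb A that] by blast
  have vv: "v j \<bullet> v j = 1" if "j \<in> {1..n}" for j
    using gkb_vectors(2)[OF gkb A that] by blast
  from Suc have J: "J + 1 \<le> n"
    and IHu: "\<And>i j. i \<in> {1..J + 1} \<Longrightarrow> j \<in> {1..J + 1} \<Longrightarrow> u i \<bullet> u j = (if i = j then 1 else 0)"
    and IHv: "\<And>i j. i \<in> {1..J} \<Longrightarrow> j \<in> {1..J} \<Longrightarrow> v i \<bullet> v j = (if i = j then 1 else 0)"
    by auto
  have \<alpha>: "\<alpha> (J + 1) \<noteq> 0" and \<beta>: "\<beta> (J + 2) \<noteq> 0"
    using gkb_vectors[OF gkb A, of "J + 1"] gkb_vectors[OF gkb A, of "J + 2"] J by auto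
  have adj: "(A\<^sup>T *\<^sub>v u i) \<bullet> v j = u i \<bullet> (A *\<^sub>v v j)" if "i \<in> {1..n + 1}" "j \<in> {1..n}" for i j
    by (rule transpose_vec_mult_scalar[OF A vc[OF that(2)] uc[OF that(1)]])
  have newv: "v (J + 1) \<bullet> v i = 0" if i: "i \<in> {1..J}" for i
  proof -
    have c: "v (J + 1) \<in> carrier_vec N" "v J \<in> carrier_vec N" "v i \<in> carrier_vec N"
      "u (J + 1) \<in> carrier_vec M" "u i \<in> carrier_vec M" "u (i + 1) \<in> carrier_vec M"
      using i J uc vc by auto
    have "\<alpha> (J + 1) * (v (J + 1) \<bullet> v i) + \<beta> (J + 1) * (v J \<bullet> v i) = (A\<^sup>T *\<^sub>v u (J + 1)) \<bullet> v i"
      using gkb_transpose_mult_u[OF gkb A, of J] i J c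
      by (simp add: add_scalar_prod_distrib[of _ N])
    also have "\<dots> = \<alpha> i * (u (J + 1) \<bullet> u i) + \<beta> (i + 1) * (u (J + 1) \<bullet> u (i + 1))"
      using adj[of "J + 1" i] gkb_mult_v[OF gkb A, of i] i J c
      by (simp add: scalar_prod_add_distrib[of _ M])
    finally show ?thesis
      using IHu[of "J + 1" i] IHu[of "J + 1" "i + 1"] IHv[of J i] i \<alpha> by (auto split: if_splits)
  qed
  have newV: "v i \<bullet> v j = (if i = j then 1 else 0)" if "i \<in> {1..J + 1}" "j \<in> {1..J + 1}" for i j
  proof -
    have "v i \<bullet> v j = v j \<bullet> v i"
      using that J vc by (intro comm_scalar_prod[of _ N]) auto
    moreover have "i \<in> {1..J} \<or> i = J + 1" "j \<in> {1..J} \<or> j = J + 1"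
      using that by auto
    ultimately show ?thesis
      using IHv[of i j] newv[of i] newv[of j] vv[of "J + 1"] J by auto
  qed
  have newu: "u i \<bullet> u (J + 2) = 0" if i: "i \<in> {1..J + 1}" for i
  proof -
    have c: "u (J + 1) \<in> carrier_vec M" "u (J + 2) \<in> carrier_vec M" "u i \<in> carrier_vec M"
      "v (J + 1) \<in> carrier_vec N" "v i \<in> carrier_vec N"
      using i J uc vc by auto
    have "\<alpha> (J + 1) * (u i \<bullet> u (J + 1)) + \<beta> (J + 2) * (u i \<bullet> u (J + 2)) = (A\<^sup>T *\<^sub>v u i) \<bullet> v (J + 1)"
      using adj[of i "J + 1"] gkb_mult_v[OF gkb A, of "J + 1"] i J c
      by (simp add: scalar_prod_add_distrib[of _ M])
    also have "\<dots> = \<alpha> i * (v i \<bullet> v (J + 1))"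
    proof (cases "i = 1")
      case True
      have "A\<^sup>T *\<^sub>v u 1 = \<alpha> 1 \<cdot>\<^sub>v v 1"
        using gkb J unfolding gkb_def by simp
      then show ?thesis
        using True c by simp
    next
      case False
      then have i': "i - 1 \<in> {1..<n}" "i - 1 + 1 = i"
        using i J by auto
      then have "v (i - 1) \<in> carrier_vec N"
        by (intro vc) auto
      moreover have "v (i - 1) \<bullet> v (J + 1) = 0"
        using newV[of "i - 1" "J + 1"] i' i J False by auto
      ultimately show ?thesis
        using gkb_transpose_mult_u[OF gkb A i'(1)] i' c
        by (simp add: add_scalar_prod_distrib[of _ N])
    qed
    finally show ?thesis
      using newV[of i "J + 1"] IHu[of i "J + 1"] i \<beta> by (auto split: if_splits)
  qed
  have newU: "u i \<bullet> u j = (if i = j then 1 else 0)" if "i \<in> {1..J + 2}" "j \<in> {1..J + 2}" for i j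
  proof -
    have "u i \<bullet> u j = u j \<bullet> u i"
      using that J uc by (intro comm_scalar_prod[of _ M]) auto
    moreover have "i \<in> {1..J + 1} \<or> i = J + 2" "j \<in> {1..J + 1} \<or> j = J + 2"
      using that by auto
    ultimately show ?thesis
      using IHu[of i j] newu[of i] newu[of j] uu[of "J + 2"] J by auto
  qed
  show ?case
    using newU newV by simp
qed

lemma orthonormal_cols_upto:
  assumes v: "\<And>j. j \<in> {1..n} \<Longrightarrow> v j \<in> carrier_vec d"
    and prod: "\<And>i j. i \<in> {1..n} \<Longrightarrow> j \<in> {1..n} \<Longrightarrow> v i \<bullet> v j = (if i = j then 1 else 0)"
  shows "orthonormal_cols (cols_upto d v n)"
proof (rule orthonormal_colsI)
  fix i j assume "i < dim_col (cols_upto d v n)" "j < dim_col (cols_upto d v n)"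
  then have ij: "i < n" "j < n"
    unfolding carrier_matD(2)[OF cols_upto_carrier] .
  then have mem: "i + 1 \<in> {1..n}" "j + 1 \<in> {1..n}"
    by auto
  show "col (cols_upto d v n) i \<bullet> col (cols_upto d v n) j = (if i = j then 1 else 0)"
    using prod[OF mem]
    unfolding col_cols_upto[of i n v d, OF ij(1) v[OF mem(1)]]
      col_cols_upto[of j n v d, OF ij(2) v[OF mem(2)]]
    by (simp only: add_right_cancel)
qed

lemma gkb_orthonormal:
  assumes gkb: "gkb A b n \<alpha> \<beta> u v" and A: "A \<in> carrier_mat M N"
  shows "orthonormal_cols (cols_upto M u (n + 1))" "orthonormal_cols (cols_upto N v n)"
proof -
  note orth = gkb_orthonormal_vectors[OF gkb A order_refl]
  show "orthonormal_cols (cols_upto M u (n + 1))"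
    by (rule orthonormal_cols_upto[OF gkb_carrier(1)[OF gkb A] conjunct1[OF orth, rule_format]])
  show "orthonormal_cols (cols_upto N v n)"
    by (rule orthonormal_cols_upto[OF gkb_carrier(2)[OF gkb A] conjunct2[OF orth, rule_format]])
qed

lemma gkb_prefix:
  assumes gkb: "gkb A b n \<alpha> \<beta> u v" and m: "m \<le> n"
  shows "gkb A b m \<alpha> \<beta> u v"
proof -
  have "{1..m + 1} \<subseteq> {1..n + 1}" "{1..m} \<subseteq> {1..n}" "{1..<m} \<subseteq> {1..<n}" "1 \<le> m \<Longrightarrow> 1 \<le> n"
    using m by auto
  then show ?thesis
    using gkb unfolding gkb_def by (elim conjE, intro conjI) (blast | assumption)+
qed

lemma gkb_prefix_orthogonal:
  assumes gkb: "gkb A b n \<alpha> \<beta> u v" and A: "A \<in> carrier_mat M N"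
    and i: "p < i" "i \<le> n + 1"
  shows "(cols_upto M u p)\<^sup>T *\<^sub>v u i = 0\<^sub>v p"
proof (rule eq_vecI)
  fix r assume "r < dim_vec (0\<^sub>v p :: real vec)"
  then have r: "r < p" by simp
  have "u (r + 1) \<bullet> u i = 0"
    using gkb_orthonormal_vectors[OF gkb A order_refl] r i by auto
  moreover have "u (r + 1) \<in> carrier_vec M"
    using r i by (intro gkb_carrier(1)[OF gkb A]) auto
  ultimately show "((cols_upto M u p)\<^sup>T *\<^sub>v u i) $ r = (0\<^sub>v p :: real vec) $ r"
    using r cols_upto_carrier[of M u p] by (simp add: col_cols_upto)
qed (use cols_upto_carrier[of M u p] in simp)

text \<open>
  For \<open>Y\<close> in the range of the first \<open>m + 1\<close> left vectors, only the first \<open>m + 1\<close> columns of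
  \<open>Y\<^sup>T A V\<close> can be nonzero: column \<open>j\<close> combines \<open>Y\<^sup>T u j\<close> and \<open>Y\<^sup>T u (j + 1)\<close>, which vanish beyond
  \<open>m + 1\<close>.  The first \<open>m\<close> columns form \<open>S\<^sup>T B\<^sub>m\<close>.  Column \<open>m + 1\<close> is
  \<open>\<alpha> (m + 1) Y\<^sup>T u (m + 1)\<close>, of norm at most \<open>\<alpha> (m + 1)\<close> by Bessel.
\<close>

lemma frobenius_transpose_mult_gkb_le:
  assumes gkb: "gkb A b (m + l) \<alpha> \<beta> u v" and A: "A \<in> carrier_mat M N" and l: "1 \<le> l"
    and S: "S \<in> carrier_mat (m + 1) k" and Y: "Y = cols_upto M u (m + 1) * S" "orthonormal_cols Y"
  shows "(frobenius_norm (Y\<^sup>T * (A * cols_upto N v (m + l))))\<^sup>2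
    \<le> (frobenius_norm (S\<^sup>T * bidiag \<alpha> \<beta> m))\<^sup>2 + (\<alpha> (m + 1))\<^sup>2"
proof -
  let ?U = "cols_upto M u (m + 1)" and ?V = "cols_upto N v (m + l)" and ?B = "bidiag \<alpha> \<beta> m"
  note uc = gkb_carrier(1)[OF gkb A] and vc = gkb_carrier(2)[OF gkb A]
  note gkbm = gkb_prefix[OF gkb le_add1]
  note U = cols_upto_carrier[of M u "m + 1"] and V = cols_upto_carrier[of N v "m + l"]
    and Vm = cols_upto_carrier[of N v m] and Bc = bidiag_carrier[of \<alpha> \<beta> m]
  have Yc: "Y \<in> carrier_mat M k" and Yt: "Y\<^sup>T \<in> carrier_mat k M" and St: "S\<^sup>T \<in> carrier_mat k (m + 1)"
    and Ut: "?U\<^sup>T \<in> carrier_mat (m + 1) M"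
    using U S Y by auto
  have Yt_eq: "Y\<^sup>T = S\<^sup>T * ?U\<^sup>T"
    unfolding Y(1) by (rule transpose_mult[OF U S])
  have Yu_zero: "Y\<^sup>T *\<^sub>v u i = 0\<^sub>v k" if "m + 1 < i" "i \<le> m + l + 1" for i
  proof -
    have "u i \<in> carrier_vec M"
      using that by (intro uc) auto
    then have "Y\<^sup>T *\<^sub>v u i = S\<^sup>T *\<^sub>v (?U\<^sup>T *\<^sub>v u i)"
      unfolding Yt_eq by (rule assoc_mult_mat_vec[OF St Ut])
    also have "?U\<^sup>T *\<^sub>v u i = 0\<^sub>v (m + 1)"
      using that by (intro gkb_prefix_orthogonal[OF gkb A]) auto
    finally show ?thesis
      using St by (intro eq_vecI) auto
  qed
  define f where "f j = (norm2 (Y\<^sup>T *\<^sub>v (A *\<^sub>v v (j + 1))))\<^sup>2" for j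
  have col: "col (Y\<^sup>T * (A * ?V)) j = Y\<^sup>T *\<^sub>v (A *\<^sub>v v (j + 1))" if "j < m + l" for j
  proof -
    have "v (j + 1) \<in> carrier_vec N"
      using that by (intro vc) auto
    then show ?thesis
      using that by (simp only: col_mult2[OF Yt mult_carrier_mat[OF A V]] col_mult2[OF A V] col_cols_upto)
  qed
  have Av: "Y\<^sup>T *\<^sub>v (A *\<^sub>v v j) = \<alpha> j \<cdot>\<^sub>v (Y\<^sup>T *\<^sub>v u j) + \<beta> (j + 1) \<cdot>\<^sub>v (Y\<^sup>T *\<^sub>v u (j + 1))"
    if j: "j \<in> {1..m + l}" for j
  proof -
    have c: "u j \<in> carrier_vec M" "u (j + 1) \<in> carrier_vec M"
      using j by (auto intro: uc)
    then have c': "\<alpha> j \<cdot>\<^sub>v u j \<in> carrier_vec M" "\<beta> (j + 1) \<cdot>\<^sub>v u (j + 1) \<in> carrier_vec M"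
      by simp_all
    show ?thesis
      by (simp only: gkb_mult_v[OF gkb A j] mult_add_distrib_mat_vec[OF Yt c']
          mult_mat_vec[OF Yt c(1)] mult_mat_vec[OF Yt c(2)])
  qed
  have first: "(\<Sum>j<m. f j) = (frobenius_norm (S\<^sup>T * ?B))\<^sup>2"
  proof -
    have "Y\<^sup>T * (A * cols_upto N v m) = S\<^sup>T * ?B"
    proof -
      have "A * cols_upto N v m = ?U * ?B"
        using gkb_carrier[OF gkbm A] gkb_mult_v[OF gkbm A] by (intro bidiag_relation[OF A]) auto
      then have "Y\<^sup>T * (A * cols_upto N v m) = S\<^sup>T * ?U\<^sup>T * (?U * ?B)"
        by (simp only: Yt_eq)
      also have "\<dots> = S\<^sup>T * (?U\<^sup>T * (?U * ?B))"
        by (rule assoc_mult_mat[OF St Ut mult_carrier_mat[OF U Bc]])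
      also have "?U\<^sup>T * (?U * ?B) = ?U\<^sup>T * ?U * ?B"
        by (rule assoc_mult_mat[OF Ut U Bc, symmetric])
      also have "\<dots> = ?B"
        unfolding orthonormal_colsD[OF gkb_orthonormal(1)[OF gkbm A] U] using Bc by simp
      finally show ?thesis .
    qed
    moreover have "col (Y\<^sup>T * (A * cols_upto N v m)) j = Y\<^sup>T *\<^sub>v (A *\<^sub>v v (j + 1))" if "j < m" for j
    proof -
      have "v (j + 1) \<in> carrier_vec N"
        using that by (intro vc) auto
      then show ?thesis
        using that
        by (simp only: col_mult2[OF Yt mult_carrier_mat[OF A Vm]] col_mult2[OF A Vm] col_cols_upto)
    qed
    ultimately show ?thesis
      using Bc by (simp add: frobenius_sq_cols f_def)
  qed
  have middle: "f m \<le> (\<alpha> (m + 1))\<^sup>2"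
  proof -
    have um: "u (m + 1) \<in> carrier_vec M" "u (m + 1) \<bullet> u (m + 1) = 1"
      using gkb_vectors(1)[OF gkb A, of "m + 1"] by auto
    have "Y\<^sup>T *\<^sub>v (A *\<^sub>v v (m + 1)) = \<alpha> (m + 1) \<cdot>\<^sub>v (Y\<^sup>T *\<^sub>v u (m + 1))"
    proof -
      have "x + c \<cdot>\<^sub>v 0\<^sub>v k = x" if "x \<in> carrier_vec k" for x :: "real vec" and c
        using that by (intro eq_vecI) auto
      then show ?thesis
        using Av[of "m + 1"] Yu_zero[of "m + 1 + 1"] l mult_mat_vec_carrier[OF Yt um(1)] by simp
    qed
    then have "f m = (\<alpha> (m + 1))\<^sup>2 * (norm2 (Y\<^sup>T *\<^sub>v u (m + 1)))\<^sup>2"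
      by (simp add: f_def norm2_smult_sq)
    also have "\<dots> \<le> (\<alpha> (m + 1))\<^sup>2 * (norm2 (u (m + 1)))\<^sup>2"
      by (intro mult_left_mono bessel_inequality[OF Yc Y(2) um(1)]) simp
    finally show ?thesis
      using um(2) by (simp add: norm2_sq)
  qed
  have last: "f j = 0" if "m < j" "j < m + l" for j
  proof -
    have "\<alpha> (j + 1) \<cdot>\<^sub>v 0\<^sub>v k + \<beta> (j + 1 + 1) \<cdot>\<^sub>v 0\<^sub>v k = 0\<^sub>v k"
      by (intro eq_vecI) auto
    then show ?thesis
      using Av[of "j + 1"] Yu_zero[of "j + 1"] Yu_zero[of "j + 1 + 1"] that
      by (simp add: f_def norm2_zero)
  qed
  have "(frobenius_norm (Y\<^sup>T * (A * ?V)))\<^sup>2 = (\<Sum>j<m + l. f j)"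
    using V col by (simp add: frobenius_sq_cols f_def)
  also have "\<dots> = (\<Sum>j<m + 1. f j)"
    using l last by (intro sum.mono_neutral_right) auto
  also have "\<dots> = (\<Sum>j<m. f j) + f m"
    by simp
  finally show ?thesis
    using first middle by simp
qed

section \<open>The recycled space and its image\<close>

lemma right_inverse_of_injective:
  fixes R :: "real mat"
  assumes R: "R \<in> carrier_mat k k"
    and inj: "\<And>w. w \<in> carrier_vec k \<Longrightarrow> R *\<^sub>v w = 0\<^sub>v k \<Longrightarrow> w = 0\<^sub>v k"
  obtains R' where "R' \<in> carrier_mat k k" "R * R' = 1\<^sub>m k"
proof -
  have "det R \<noteq> 0"
    using det_0_iff_vec_prod_zero_field[OF R] inj by blast
  then have "R \<in> Units (ring_mat TYPE(real) k ())"
    by (rule det_non_zero_imp_unit[OF R])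
  then show ?thesis
    using that by (auto simp: Units_def ring_mat_def)
qed

text \<open>
  The columns of \<open>Y\<close> span the image \<open>A W = U B X\<close>, which lies in the range of \<open>U\<close>.  Solving for \<open>Y\<close>
  requires \<open>R\<close> to be invertible; it is, because \<open>A\<close> is injective on the range of \<open>V\<close> (there it acts as
  the injective \<open>B\<close>) and \<open>W\<close> has independent columns in that range.
\<close>

lemma qr_factor_range:
  assumes W: "W \<in> carrier_mat N k" "orthonormal_cols W" and X: "X \<in> carrier_mat m k" "W = V * X"
    and V: "V \<in> carrier_mat N m" and U: "U \<in> carrier_mat M r" "orthonormal_cols U"
    and B: "B \<in> carrier_mat r m" and A: "A \<in> carrier_mat M N" and AV: "A * V = U * B"
    and inj: "\<And>z. z \<in> carrier_vec m \<Longrightarrow> B *\<^sub>v z = 0\<^sub>v r \<Longrightarrow> z = 0\<^sub>v m"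
    and Y: "Y \<in> carrier_mat M k" and R: "R \<in> carrier_mat k k" and qr: "A * W = Y * R"
  obtains S where "S \<in> carrier_mat r k" "Y = U * S"
proof -
  have BX: "B * X \<in> carrier_mat r k"
    using B X by auto
  have AW: "A * W = U * (B * X)"
  proof -
    have "A * W = A * V * X"
      unfolding X(2) by (rule assoc_mult_mat[OF A V X(1), symmetric])
    then show ?thesis
      unfolding AV by (simp only: assoc_mult_mat[OF U(1) B X(1)])
  qed
  have "w = 0\<^sub>v k" if w: "w \<in> carrier_vec k" and Rw: "R *\<^sub>v w = 0\<^sub>v k" for w
  proof -
    have Xw: "X *\<^sub>v w \<in> carrier_vec m" and BXw: "B *\<^sub>v (X *\<^sub>v w) \<in> carrier_vec r"
      using X B w by auto
    have "U *\<^sub>v (B *\<^sub>v (X *\<^sub>v w)) = A * W *\<^sub>v w"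
      unfolding AW assoc_mult_mat_vec[OF U(1) BX w] assoc_mult_mat_vec[OF B X(1) w] ..
    also have "\<dots> = 0\<^sub>v M"
      unfolding qr assoc_mult_mat_vec[OF Y R w] Rw using Y by (intro eq_vecI) auto
    finally have "norm2 (B *\<^sub>v (X *\<^sub>v w)) = 0"
      using norm2_orthonormal_mult[OF U BXw] by (simp add: norm2_zero)
    then have "X *\<^sub>v w = 0\<^sub>v m"
      using inj[OF Xw] norm2_eq_zero[OF _ BXw] by simp
    then have "W *\<^sub>v w = 0\<^sub>v N"
      unfolding X(2) assoc_mult_mat_vec[OF V X(1) w] using V by (intro eq_vecI) auto
    then have "norm2 w = 0"
      using norm2_orthonormal_mult[OF W w] by (simp add: norm2_zero)
    then show ?thesis
      using w by (rule norm2_eq_zero)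
  qed
  then obtain R' where R': "R' \<in> carrier_mat k k" "R * R' = 1\<^sub>m k"
    using right_inverse_of_injective[OF R] by blast
  have "Y = Y * (R * R')"
    using Y R' by simp
  also have "\<dots> = Y * R * R'"
    by (rule assoc_mult_mat[OF Y R R'(1), symmetric])
  also have "\<dots> = U * (B * X * R')"
    unfolding qr[symmetric] AW by (rule assoc_mult_mat[OF U(1) BX R'(1)])
  finally show ?thesis
    using that mult_carrier_mat[OF BX R'(1)] by blast
qed

text \<open>
  Since \<open>Y\<close> preserves norms, the columns of \<open>R\<close> are as long as those of \<open>A W\<close>.  The first \<open>k - 1\<close> of
  these are images of right singular vectors, of lengths \<open>\<sigma> 1, \<dots>, \<sigma> (k - 1)\<close>.  For the last column it
  suffices to keep its diagonal entry.
\<close>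

lemma tsvd_triangular_factor_energy:
  assumes gkb: "gkb A b m \<alpha> \<beta> u v" and A: "A \<in> carrier_mat M N" and k: "1 \<le> k" "k \<le> m"
    and svd: "is_svd (bidiag \<alpha> \<beta> m) \<Psi> \<sigma> \<Phi>"
    and W0: "W0 = cols_upto N v m * mat_of_cols m (take (k - 1) (cols \<Phi>))"
    and W: "W = W0 @\<^sub>c C" "C \<in> carrier_mat N 1"
    and Y: "Y \<in> carrier_mat M k" "orthonormal_cols Y" and R: "R \<in> carrier_mat k k" and qr: "A * W = Y * R"
  shows "(\<Sum>i<k - 1. (\<sigma> (i + 1))\<^sup>2) + (R $$ (k - 1, k - 1))\<^sup>2 \<le> (frobenius_norm R)\<^sup>2"
proof -
  let ?V = "cols_upto N v m" and ?U = "cols_upto M u (m + 1)" and ?B = "bidiag \<alpha> \<beta> m"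
  let ?F = "mat_of_cols m (take (k - 1) (cols \<Phi>))"
  note V = cols_upto_carrier[of N v m] and U = cols_upto_carrier[of M u "m + 1"]
    and B = bidiag_carrier[of \<alpha> \<beta> m]
  have "length (take (k - 1) (cols \<Phi>)) = k - 1"
    using k carrier_matD(2)[OF is_svdD(3)[OF svd B]] by simp
  then have F: "?F \<in> carrier_mat m (k - 1)"
    by (intro carrier_matI) simp_all
  have W0c: "W0 \<in> carrier_mat N (k - 1)"
    unfolding W0 by (rule mult_carrier_mat[OF V F])
  have Wc: "W \<in> carrier_mat N k"
    using append_cols_carrier[OF W0c W(2)] k unfolding W(1) by simp
  have AV: "A * ?V = ?U * ?B"
    using gkb_carrier[OF gkb A] gkb_mult_v[OF gkb A] by (intro bidiag_relation[OF A]) auto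
  have AW0: "A * W0 = ?U * (?B * ?F)"
    unfolding W0 assoc_mult_mat[OF A V F, symmetric] AV by (rule assoc_mult_mat[OF U B F])
  have "(\<Sum>i<k - 1. (\<sigma> (i + 1))\<^sup>2) = (frobenius_norm (?B * ?F))\<^sup>2"
    using k by (intro frobenius_leading_right_singular[OF svd B, symmetric]) auto
  also have "\<dots> = (frobenius_norm (A * W0))\<^sup>2"
    unfolding AW0
    by (rule frobenius_orthonormal_mult[OF U gkb_orthonormal(1)[OF gkb A]
          mult_carrier_mat[OF B F], symmetric])
  also have "\<dots> = (\<Sum>j<k - 1. (norm2 (col R j))\<^sup>2)"
  proof -
    have "(norm2 (col (A * W0) j))\<^sup>2 = (norm2 (col R j))\<^sup>2" if j: "j < k - 1" for j
    proof -
      have jk: "j < k" "j < k - 1 + 1" using j by auto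
      have cR: "col R j \<in> carrier_vec k"
        using R by auto
      have "col (A * W0) j = A *\<^sub>v col W j"
        using j unfolding W(1) by (simp only: col_mult2[OF A W0c j] col_append_cols[OF W0c W(2) jk(2)] if_True)
      also have "\<dots> = Y *\<^sub>v col R j"
        unfolding col_mult2[OF A Wc jk(1), symmetric] qr by (rule col_mult2[OF Y(1) R jk(1)])
      finally show ?thesis
        using norm2_orthonormal_mult[OF Y cR] by simp
    qed
    then show ?thesis
      using carrier_matD(2)[OF W0c] by (simp add: frobenius_sq_cols)
  qed
  finally have head: "(\<Sum>i<k - 1. (\<sigma> (i + 1))\<^sup>2) = (\<Sum>j<k - 1. (norm2 (col R j))\<^sup>2)" .
  have "(col R (k - 1) $ (k - 1))\<^sup>2 \<le> (\<Sum>i<dim_vec (col R (k - 1)). (col R (k - 1) $ i)\<^sup>2)"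
    using R k by (intro member_le_sum) auto
  then have last: "(R $$ (k - 1, k - 1))\<^sup>2 \<le> (norm2 (col R (k - 1)))\<^sup>2"
    using R k by (simp add: norm2_sq_sum)
  have "(frobenius_norm R)\<^sup>2 = (\<Sum>j<Suc (k - 1). (norm2 (col R j))\<^sup>2)"
    using R k by (simp add: frobenius_sq_cols)
  then show ?thesis
    using head last by simp
qed

section \<open>Recycling Golub-Kahan bidiagonalization\<close>

lemma recycling_gkb_vectors:
  assumes rg: "recycling_gkb A Y b l \<alpha> \<beta> u v" and A: "A \<in> carrier_mat M N"
    and j: "j \<in> {1..l + 1}"
  shows "u j \<in> carrier_vec M" "v j \<in> carrier_vec N" "v j \<bullet> v j = 1" "0 < \<beta> j"
proof -
  have "\<forall>j\<in>{1..l + 1}. u j \<in> carrier_vec (dim_row A) \<and> norm2 (u j) = 1 \<and> 0 < \<beta> j"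
    using rg unfolding recycling_gkb_def by (elim conjE)
  then show "u j \<in> carrier_vec M" "0 < \<beta> j"
    using A j by auto
  have "\<forall>j\<in>{1..l + 1}. v j \<in> carrier_vec (dim_col A) \<and> norm2 (v j) = 1 \<and> 0 < \<alpha> j"
    using rg unfolding recycling_gkb_def by (elim conjE)
  then show "v j \<in> carrier_vec N" "v j \<bullet> v j = 1"
    using A j norm2_sq[of "v j"] by auto
qed

lemma recycling_gkb_mult_v:
  assumes rg: "recycling_gkb A Y b l \<alpha> \<beta> u v" and A: "A \<in> carrier_mat M N"
    and Y: "Y \<in> carrier_mat M k" and j: "j \<in> {1..l}"
  shows "A *\<^sub>v v j - Y *\<^sub>v (Y\<^sup>T *\<^sub>v (A *\<^sub>v v j)) = \<alpha> j \<cdot>\<^sub>v u j + \<beta> (j + 1) \<cdot>\<^sub>v u (j + 1)"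
proof -
  have c: "v j \<in> carrier_vec N" "u j \<in> carrier_vec M" "u (j + 1) \<in> carrier_vec M"
    using recycling_gkb_vectors[OF rg A] j by auto
  have Av: "A *\<^sub>v v j \<in> carrier_vec M"
    using A c by auto
  have Yt: "Y\<^sup>T \<in> carrier_mat k M"
    using Y by simp
  have proj: "(1\<^sub>m M - Y * Y\<^sup>T) *\<^sub>v (A *\<^sub>v v j) = A *\<^sub>v v j - Y *\<^sub>v (Y\<^sup>T *\<^sub>v (A *\<^sub>v v j))"
    using minus_mult_distrib_mat_vec[OF one_carrier_mat mult_carrier_mat[OF Y Yt] Av]
    by (simp only: assoc_mult_mat_vec[OF Y Yt Av] one_mult_mat_vec[OF Av])
  have "\<beta> (j + 1) \<cdot>\<^sub>v u (j + 1)
      = (1\<^sub>m M - Y * Y\<^sup>T) *\<^sub>v (A *\<^sub>v v j) - \<alpha> j \<cdot>\<^sub>v u j"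
    using rg j carrier_matD(1)[OF A] unfolding recycling_gkb_def by blast
  then have "A *\<^sub>v v j - Y *\<^sub>v (Y\<^sup>T *\<^sub>v (A *\<^sub>v v j)) = \<beta> (j + 1) \<cdot>\<^sub>v u (j + 1) + \<alpha> j \<cdot>\<^sub>v u j"
    unfolding proj using c Av Y by (intro eq_add_of_eq_minus[of _ _ _ M]) auto
  also have "\<dots> = \<alpha> j \<cdot>\<^sub>v u j + \<beta> (j + 1) \<cdot>\<^sub>v u (j + 1)"
    using c by (intro comm_add_vec[of _ M]) auto
  finally show ?thesis .
qed

lemma recycling_gkb_transpose_mult_u:
  assumes rg: "recycling_gkb A Y b l \<alpha> \<beta> u v" and A: "A \<in> carrier_mat M N" and j: "j \<in> {1..l}"
  shows "A\<^sup>T *\<^sub>v u (j + 1) = \<alpha> (j + 1) \<cdot>\<^sub>v v (j + 1) + \<beta> (j + 1) \<cdot>\<^sub>v v j"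
proof -
  have c: "v j \<in> carrier_vec N" "u (j + 1) \<in> carrier_vec M"
    using recycling_gkb_vectors[OF rg A] j by auto
  have "\<alpha> (j + 1) \<cdot>\<^sub>v v (j + 1) = A\<^sup>T *\<^sub>v u (j + 1) - \<beta> (j + 1) \<cdot>\<^sub>v v j"
    using rg j unfolding recycling_gkb_def by blast
  then show ?thesis
    using c A by (intro eq_add_of_eq_minus[of _ _ _ N]) auto
qed

text \<open>
  The projected process bidiagonalizes \<open>A - Y Y\<^sup>T A\<close>; the component removed by the projection
  reappears as the first summand.
\<close>

lemma recycling_gkb_relation:
  assumes rg: "recycling_gkb A Y b l \<alpha> \<beta> u v" and A: "A \<in> carrier_mat M N" and Y: "Y \<in> carrier_mat M k"
  shows "A * cols_upto N v l
    = Y * (Y\<^sup>T * A * cols_upto N v l) + cols_upto M u (l + 1) * bidiag \<alpha> \<beta> l"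
proof -
  let ?V = "cols_upto N v l" and ?X = "A - Y * (Y\<^sup>T * A)"
  note V = cols_upto_carrier[of N v l]
  have Yt: "Y\<^sup>T \<in> carrier_mat k M"
    using Y by simp
  have YtA: "Y\<^sup>T * A \<in> carrier_mat k N"
    using Yt A by auto
  have YYA: "Y * (Y\<^sup>T * A) \<in> carrier_mat M N"
    by (rule mult_carrier_mat[OF Y YtA])
  have X: "?X \<in> carrier_mat M N"
    by (rule minus_carrier_mat[OF YYA])
  have "?X *\<^sub>v v j = \<alpha> j \<cdot>\<^sub>v u j + \<beta> (j + 1) \<cdot>\<^sub>v u (j + 1)" if j: "j \<in> {1..l}" for j
  proof -
    have v: "v j \<in> carrier_vec N"
      using j by (intro recycling_gkb_vectors(2)[OF rg A]) auto
    show ?thesis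
      unfolding minus_mult_distrib_mat_vec[OF A YYA v] assoc_mult_mat_vec[OF Y YtA v]
        assoc_mult_mat_vec[OF Yt A v]
      by (rule recycling_gkb_mult_v[OF rg A Y j])
  qed
  then have "?X * ?V = cols_upto M u (l + 1) * bidiag \<alpha> \<beta> l"
    using recycling_gkb_vectors(1,2)[OF rg A] by (intro bidiag_relation[OF X]) auto
  moreover have "?X * ?V = A * ?V - Y * (Y\<^sup>T * A * ?V)"
    unfolding minus_mult_distrib_mat[OF A YYA V] assoc_mult_mat[OF Y YtA V] ..
  moreover have "A * ?V \<in> carrier_mat M l" "Y * (Y\<^sup>T * A * ?V) \<in> carrier_mat M l"
    by (intro mult_carrier_mat[OF A V] mult_carrier_mat[OF Y] mult_carrier_mat[OF YtA V])+
  moreover have "a = c + (a - c)" if "a \<in> carrier_mat M l" "c \<in> carrier_mat M l" for a c :: "real mat"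
    using that by (intro eq_matI) auto
  ultimately show ?thesis
    by metis
qed

text \<open>
  By the transposed recurrence, \<open>A\<^sup>T u j\<close> is a combination of \<open>v (j - 1)\<close> and \<open>v j\<close>.  A family \<open>P\<close>
  orthogonal to \<open>v 1, \<dots>, v l\<close> therefore sees only the component of \<open>A\<^sup>T u (l + 1)\<close> along
  \<open>v (l + 1)\<close>, whose coefficient is \<open>\<alpha> (l + 1)\<close>.
\<close>

lemma recycling_gkb_tail_le:
  assumes rg: "recycling_gkb A Y b l \<alpha> \<beta> u v" and A: "A \<in> carrier_mat M N"
    and P: "P \<in> carrier_mat N q" "orthonormal_cols P" and PV: "P\<^sup>T * cols_upto N v l = 0\<^sub>m q l"
  shows "(frobenius_norm ((cols_upto M u (l + 1))\<^sup>T * (A * P)))\<^sup>2 \<le> (\<alpha> (l + 1))\<^sup>2"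
proof -
  let ?U = "cols_upto M u (l + 1)" and ?V = "cols_upto N v l"
  note U = cols_upto_carrier[of M u "l + 1"] and V = cols_upto_carrier[of N v l]
  have Pt: "P\<^sup>T \<in> carrier_mat q N" and At: "A\<^sup>T \<in> carrier_mat N M" and Ut: "?U\<^sup>T \<in> carrier_mat (l + 1) M"
    using P A U by auto
  note uc = recycling_gkb_vectors(1)[OF rg A] and vc = recycling_gkb_vectors(2)[OF rg A]
  have Pv: "P\<^sup>T *\<^sub>v v j = 0\<^sub>v q" if "j \<in> {1..l}" for j
  proof -
    have j: "j - 1 < l" "j - 1 + 1 = j" "v j \<in> carrier_vec N"
      using that vc by auto
    then have "P\<^sup>T *\<^sub>v v j = col (P\<^sup>T * ?V) (j - 1)"
      using col_cols_upto[of "j - 1" l v N] by (simp only: col_mult2[OF Pt V j(1)])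
    also have "\<dots> = 0\<^sub>v q"
      unfolding PV using j(1) by (intro eq_vecI) auto
    finally show ?thesis .
  qed
  have step: "P\<^sup>T *\<^sub>v (A\<^sup>T *\<^sub>v u j) = \<alpha> j \<cdot>\<^sub>v (P\<^sup>T *\<^sub>v v j)" if j: "j \<in> {1..l + 1}" for j
  proof (cases "j = 1")
    case True
    have "A\<^sup>T *\<^sub>v u 1 = \<alpha> 1 \<cdot>\<^sub>v v 1"
      using rg unfolding recycling_gkb_def by simp
    then show ?thesis
      using True mult_mat_vec[OF Pt vc[OF j]] by simp
  next
    case False
    then have i: "j - 1 \<in> {1..l}" "j - 1 + 1 = j" "j - 1 \<in> {1..l + 1}"
      using j by auto
    have c: "\<alpha> j \<cdot>\<^sub>v v j \<in> carrier_vec N" "\<beta> j \<cdot>\<^sub>v v (j - 1) \<in> carrier_vec N"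
      using vc[OF j] vc[OF i(3)] by auto
    have "P\<^sup>T *\<^sub>v (A\<^sup>T *\<^sub>v u j) = \<alpha> j \<cdot>\<^sub>v (P\<^sup>T *\<^sub>v v j) + \<beta> j \<cdot>\<^sub>v 0\<^sub>v q"
      using recycling_gkb_transpose_mult_u[OF rg A i(1)] unfolding i(2)
      by (simp only: mult_add_distrib_mat_vec[OF Pt c] mult_mat_vec[OF Pt vc[OF j]]
          mult_mat_vec[OF Pt vc[OF i(3)]] Pv[OF i(1)])
    then show ?thesis
      using Pt by (auto intro!: eq_vecI)
  qed
  have col: "(norm2 (col (P\<^sup>T * (A\<^sup>T * ?U)) j))\<^sup>2 = (\<alpha> (j + 1))\<^sup>2 * (norm2 (P\<^sup>T *\<^sub>v v (j + 1)))\<^sup>2"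
    if "j < l + 1" for j
  proof -
    have j: "j + 1 \<in> {1..l + 1}"
      using that by auto
    have "col (P\<^sup>T * (A\<^sup>T * ?U)) j = P\<^sup>T *\<^sub>v (A\<^sup>T *\<^sub>v u (j + 1))"
      by (simp only: col_mult2[OF Pt mult_carrier_mat[OF At U] that] col_mult2[OF At U that]
          col_cols_upto[of j "l + 1" u M, OF that uc[OF j]])
    then show ?thesis
      by (simp only: step[OF j] norm2_smult_sq)
  qed
  have "(?U\<^sup>T * (A * P))\<^sup>T = P\<^sup>T * (A\<^sup>T * ?U)"
    using transpose_mult[OF Ut mult_carrier_mat[OF A P(1)]] transpose_mult[OF A P(1)]
      assoc_mult_mat[OF Pt At U] by simp
  then have "(frobenius_norm (?U\<^sup>T * (A * P)))\<^sup>2 = (frobenius_norm (P\<^sup>T * (A\<^sup>T * ?U)))\<^sup>2"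
    using frobenius_transpose[of "?U\<^sup>T * (A * P)"] by simp
  also have "\<dots> = (\<Sum>j<l + 1. (\<alpha> (j + 1))\<^sup>2 * (norm2 (P\<^sup>T *\<^sub>v v (j + 1)))\<^sup>2)"
    using col U by (simp add: frobenius_sq_cols)
  also have "\<dots> = (\<alpha> (l + 1))\<^sup>2 * (norm2 (P\<^sup>T *\<^sub>v v (l + 1)))\<^sup>2"
    by (simp add: Pv norm2_zero)
  also have "\<dots> \<le> (\<alpha> (l + 1))\<^sup>2 * (norm2 (v (l + 1)))\<^sup>2"
    by (intro mult_left_mono bessel_inequality[OF P] vc) auto
  finally show ?thesis
    using recycling_gkb_vectors(3)[OF rg A, of "l + 1"] by (simp add: norm2_sq)
qed

section \<open>The residual bound\<close>

theorem theorem3p5: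
  fixes A :: "real mat" and b :: "real vec"
    and M N l k m :: nat and lam :: real
    and \<alpha> \<beta> \<alpha>' \<beta>' \<sigma> :: "nat \<Rightarrow> real"
    and u v u' v' :: "nat \<Rightarrow> real vec"
    and Vm Bm \<Psi> \<Phi> W0 W Y R Vl Ul Bl Bhat U V B T1 T2 Tc T Z1 Z2 Zc Z G :: "real mat"
    and x p xc r1 \<zeta> g y rhat r :: "real vec"
  assumes A: "A \<in> carrier_mat M N" and b: "b \<in> carrier_vec M"
    and l: "1 \<le> l" and k: "1 \<le> k" "k \<le> m" and lam: "0 \<le> lam"
    and gkb: "gkb A b (m + l) \<alpha> \<beta> u v"
    and V: "V = cols_upto N v (m + l)"
    and U: "U = cols_upto M u (m + l + 1)"
    and B: "B = bidiag \<alpha> \<beta> (m + l)"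
    and Vm: "Vm = cols_upto N v m"
    and Bm: "Bm = bidiag \<alpha> \<beta> m"
    and svd: "is_svd Bm \<Psi> \<sigma> \<Phi>"
    and W0: "W0 = Vm * mat_of_cols m (take (k - 1) (cols \<Phi>))"
    and x: "x \<in> column_space Vm" "x \<notin> column_space W0"
    and p: "p = x - W0 *\<^sub>v (W0\<^sup>T *\<^sub>v x)"
    and xc: "xc = (1 / norm2 p) \<cdot>\<^sub>v p"
    and W: "W = W0 @\<^sub>c mat_of_cols N [xc]"
    and qr: "is_skinny_qr (A * W) Y R"
    and r1: "r1 = b - A *\<^sub>v xc"
    and \<zeta>: "\<zeta> = Y\<^sup>T *\<^sub>v r1"
    and rgkb: "recycling_gkb A Y (r1 - Y *\<^sub>v \<zeta>) l \<alpha>' \<beta>' u' v'"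
    and Vl: "Vl = cols_upto N v' l"
    and Ul: "Ul = cols_upto M u' (l + 1)"
    and Bl: "Bl = bidiag \<alpha>' \<beta>' l"
    and Bhat: "Bhat = four_block_mat R (Y\<^sup>T * A * Vl) (0\<^sub>m (l + 1) k) Bl"
    and T_blocks: "T1 \<in> carrier_mat (m + l + 1) k" "T2 \<in> carrier_mat (m + l + 1) (l + 1)"
      "Tc \<in> carrier_mat (m + l + 1) (m - k)" "T = T1 @\<^sub>c T2 @\<^sub>c Tc"
    and T: "real_orthogonal_mat (m + l + 1) T" "Y = U * T1" "Ul = U * T2"
    and Z_blocks: "Z1 \<in> carrier_mat (m + l) k" "Z2 \<in> carrier_mat (m + l) l"
      "Zc \<in> carrier_mat (m + l) (m - k)" "Z = Z1 @\<^sub>c Z2 @\<^sub>c Zc"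
    and Z: "real_orthogonal_mat (m + l) Z" "W = V * Z1" "Vl = V * Z2"
    and g: "g = (\<zeta> + R *\<^sub>v unit_vec k (k - 1)) @\<^sub>v (\<beta>' 1 \<cdot>\<^sub>v unit_vec (l + 1) 0)"
    and y: "is_arg_min (\<lambda>w. (norm2 (Bhat *\<^sub>v w - g))\<^sup>2 + lam\<^sup>2 * (norm2 w)\<^sup>2)
              (\<lambda>w. w \<in> carrier_vec (k + l)) y"
    and rhat: "rhat = g - Bhat *\<^sub>v y"
    and G: "G = T\<^sup>T * B * Z"
    and r: "r = G\<^sup>T *\<^sub>v (T\<^sup>T *\<^sub>v (\<beta> 1 \<cdot>\<^sub>v unit_vec (m + l + 1) 0))
              - (G\<^sup>T * G + lam\<^sup>2 \<cdot>\<^sub>m 1\<^sub>m (m + l)) *\<^sub>v (y @\<^sub>v 0\<^sub>v (m - k))"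
  shows "norm2 r \<le> norm2 rhat *
           sqrt ((\<sigma> k)\<^sup>2 - (R $$ (k - 1, k - 1))\<^sup>2 + (\<alpha> (m + 1))\<^sup>2
                 - (frobenius_norm (Y\<^sup>T * A * Vl))\<^sup>2 + (\<alpha>' (l + 1))\<^sup>2)"
proof -
  have kk: "k - 1 + 1 = k" and dims: "k + l + (m - k) = m + l" "k + (l + 1) + (m - k) = m + l + 1"
    using k by auto
  note gkbm = gkb_prefix[OF gkb le_add1]
  have Vc: "V \<in> carrier_mat N (m + l)" and Uc: "U \<in> carrier_mat M (m + l + 1)"
    and Bc: "B \<in> carrier_mat (m + l + 1) (m + l)" and Vmc: "Vm \<in> carrier_mat N m"
    and Bmc: "Bm \<in> carrier_mat (m + 1) m" and Vlc: "Vl \<in> carrier_mat N l"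
    and Ulc: "Ul \<in> carrier_mat M (l + 1)" and Blc: "Bl \<in> carrier_mat (l + 1) l"
    unfolding V U B Vm Bm Vl Ul Bl by (rule cols_upto_carrier bidiag_carrier)+
  let ?Um = "cols_upto M u (m + 1)"
  note Umc = cols_upto_carrier[of M u "m + 1"]
  have Vo: "orthonormal_cols V" and Uo: "orthonormal_cols U" and Umo: "orthonormal_cols ?Um"
    using gkb_orthonormal[OF gkb A] gkb_orthonormal(1)[OF gkbm A] by (simp_all only: V U)
  have AV: "A * V = U * B"
    unfolding V U B using gkb_carrier[OF gkb A] gkb_mult_v[OF gkb A] by (intro bidiag_relation[OF A]) auto
  have AVm: "A * Vm = ?Um * Bm"
    unfolding Vm Bm using gkb_carrier[OF gkbm A] gkb_mult_v[OF gkbm A]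
    by (intro bidiag_relation[OF A]) auto
  have Tc: "T \<in> carrier_mat (m + l + 1) (m + l + 1)" "orthonormal_cols T"
    and Zo: "Z \<in> carrier_mat (m + l) (m + l)" "orthonormal_cols Z"
    using T(1) Z(1) by (simp_all add: real_orthogonal_mat_def)
  note Z12 = append_cols_carrier[OF Z_blocks(1,2)] and T12 = append_cols_carrier[OF T_blocks(1,2)]
  have Z_eq: "Z = (Z1 @\<^sub>c Z2) @\<^sub>c Zc" and T_eq: "T = (T1 @\<^sub>c T2) @\<^sub>c Tc"
    unfolding Z_blocks(4) T_blocks(4)
    by (rule append_cols_assoc[OF Z_blocks(1-3), symmetric] append_cols_assoc[OF T_blocks(1-3), symmetric])+
  note Z_orth = append_cols_orthonormalD[OF Z12 Z_blocks(3) Zo(2)[unfolded Z_eq]]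
  note Z12_orth = append_cols_orthonormalD[OF Z_blocks(1,2) Z_orth(1)]

  \<comment> \<open>The compressed vectors and the new direction are combinations of the columns of \<open>Vm\<close>.  The
    coordinate matrix \<open>X\<close> with \<open>W = Vm * X\<close> is what places \<open>Y\<close> in the range of \<open>?Um\<close> below.\<close>
  define F where "F = mat_of_cols m (take (k - 1) (cols \<Phi>))"
  have "length (take (k - 1) (cols \<Phi>)) = k - 1"
    using k carrier_matD(2)[OF is_svdD(3)[OF svd Bmc]] by simp
  then have F: "F \<in> carrier_mat m (k - 1)"
    unfolding F_def by (intro carrier_matI) simp_all
  have W0c: "W0 \<in> carrier_mat N (k - 1)"
    unfolding W0 F_def[symmetric] by (rule mult_carrier_mat[OF Vmc F])
  obtain z0 where z0: "z0 \<in> carrier_vec m" "x = Vm *\<^sub>v z0"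
    using x(1) Vmc unfolding carrier_matD(1)[OF Vmc] vec_space.col_space_eq[OF Vmc] by auto
  define z where "z = (1 / norm2 p) \<cdot>\<^sub>v (z0 - F *\<^sub>v (W0\<^sup>T *\<^sub>v x))"
  have W0tx: "W0\<^sup>T *\<^sub>v x \<in> carrier_vec (k - 1)"
    using W0c by (intro carrier_vecI) simp
  have Fw: "F *\<^sub>v (W0\<^sup>T *\<^sub>v x) \<in> carrier_vec m"
    by (rule mult_mat_vec_carrier[OF F W0tx])
  have zc: "z \<in> carrier_vec m" and zd: "z0 - F *\<^sub>v (W0\<^sup>T *\<^sub>v x) \<in> carrier_vec m"
    using z0 Fw by (simp_all add: z_def)
  have xc_eq: "xc = Vm *\<^sub>v z"
  proof -
    have "p = Vm *\<^sub>v (z0 - F *\<^sub>v (W0\<^sup>T *\<^sub>v x))"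
      unfolding p mult_minus_distrib_mat_vec[OF Vmc z0(1) Fw] z0(2)[symmetric]
        assoc_mult_mat_vec[OF Vmc F W0tx, symmetric]
      by (simp only: W0 F_def)
    then show ?thesis
      unfolding xc z_def mult_mat_vec[OF Vmc zd] by simp
  qed
  have xcc: "xc \<in> carrier_vec N"
    unfolding xc_eq by (rule mult_mat_vec_carrier[OF Vmc zc])
  have xm: "mat_of_cols N [xc] \<in> carrier_mat N 1" and zm: "mat_of_cols m [z] \<in> carrier_mat m 1"
    by (intro carrier_matI; simp)+
  have Wc: "W \<in> carrier_mat N k"
    using append_cols_carrier[OF W0c xm] unfolding W kk .
  define X where "X = F @\<^sub>c mat_of_cols m [z]"
  have X: "X \<in> carrier_mat m k"
    using append_cols_carrier[OF F zm] unfolding X_def kk .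
  have W_eq: "W = Vm * X"
    unfolding W X_def mult_append_cols[OF Vmc F zm] mult_mat_of_cols_single[OF Vmc zc] xc_eq
    by (simp only: W0 F_def)
  have Wo: "orthonormal_cols W"
    unfolding Z(2) by (rule orthonormal_cols_mult[OF Vc Vo Z_blocks(1) Z12_orth(1)])

  have AWdim: "dim_row (A * W) = M" "dim_col (A * W) = k"
    using A Wc by simp_all
  have Y: "Y \<in> carrier_mat M k" "orthonormal_cols Y" and R: "R \<in> carrier_mat k k"
    and AW: "A * W = Y * R"
    using qr unfolding is_skinny_qr_def AWdim by blast+
  have Yt: "Y\<^sup>T \<in> carrier_mat k M"
    using Y(1) by simp

  \<comment> \<open>\<open>k\<close> singular values bound \<open>Y\<^sup>T A V\<close> from above and \<open>k - 1\<close> of them bound \<open>R\<close> from below, so that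
    of all singular values only \<open>\<sigma> k\<close> survives in \<open>C_le\<close>.\<close>
  have Bm_inj: "w = 0\<^sub>v m" if "w \<in> carrier_vec m" "Bm *\<^sub>v w = 0\<^sub>v (m + 1)" for w
  proof (rule bidiag_mult_vec_eq_zero[OF _ that[unfolded Bm]])
    show "\<alpha> j \<noteq> 0" if "j \<in> {1..m}" for j
      using gkb_vectors(2)[OF gkbm A that] by auto
  qed
  obtain S where S: "S \<in> carrier_mat (m + 1) k" "Y = ?Um * S"
    by (rule qr_factor_range[OF Wc Wo X W_eq Vmc Umc Umo Bmc A AVm Bm_inj Y(1) R AW])
  have So: "orthonormal_cols S"
    using orthonormal_cols_of_mult[OF Umc Umo S(1)] Y(2) S(2) by simp
  have "(frobenius_norm (Y\<^sup>T * (A * V)))\<^sup>2 \<le> (frobenius_norm (S\<^sup>T * Bm))\<^sup>2 + (\<alpha> (m + 1))\<^sup>2"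
    unfolding V Bm by (rule frobenius_transpose_mult_gkb_le[OF gkb A l S Y(2)])
  also have "(frobenius_norm (S\<^sup>T * Bm))\<^sup>2 \<le> (\<Sum>i<k. (\<sigma> (i + 1))\<^sup>2)"
    by (rule frobenius_svd_le[OF svd Bmc le_add1 S(1) So k])
  also have "(\<Sum>i<k. (\<sigma> (i + 1))\<^sup>2) = (\<Sum>i<k - 1. (\<sigma> (i + 1))\<^sup>2) + (\<sigma> k)\<^sup>2"
    using sum.lessThan_Suc[of "\<lambda>i. (\<sigma> (i + 1))\<^sup>2" "k - 1"] k by simp
  finally have captured: "(frobenius_norm (Y\<^sup>T * (A * V)))\<^sup>2
      \<le> (\<Sum>i<k - 1. (\<sigma> (i + 1))\<^sup>2) + (\<sigma> k)\<^sup>2 + (\<alpha> (m + 1))\<^sup>2"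
    by simp
  have triangular: "(\<Sum>i<k - 1. (\<sigma> (i + 1))\<^sup>2) + (R $$ (k - 1, k - 1))\<^sup>2 \<le> (frobenius_norm R)\<^sup>2"
    by (rule tsvd_triangular_factor_energy[OF gkbm A k svd[unfolded Bm] W0[unfolded Vm] W xm Y R AW])

  \<comment> \<open>Index 1 marks the recycled directions, index 2 the directions that the recycled problem discards;
    \<open>C\<close> couples the two.\<close>
  define P1 where "P1 = W @\<^sub>c Vl"
  define P2 where "P2 = V * Zc"
  define Q1 where "Q1 = Y @\<^sub>c Ul"
  define Q2 where "Q2 = U * Tc"
  define E where "E = Y\<^sup>T * A * Vl"
  have P1: "P1 \<in> carrier_mat N (k + l)" and P2: "P2 \<in> carrier_mat N (m - k)"
    and Q1: "Q1 \<in> carrier_mat M (k + (l + 1))" and Q2: "Q2 \<in> carrier_mat M (m - k)"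
    unfolding P1_def P2_def Q1_def Q2_def
    by (rule append_cols_carrier[OF Wc Vlc] mult_carrier_mat[OF Vc Z_blocks(3)]
        append_cols_carrier[OF Y(1) Ulc] mult_carrier_mat[OF Uc T_blocks(3)])+
  have P_eq: "P1 @\<^sub>c P2 = V * Z"
    unfolding P1_def P2_def Z_eq mult_append_cols[OF Vc Z12 Z_blocks(3)]
      mult_append_cols[OF Vc Z_blocks(1,2)] Z(2,3) ..
  have Q_eq: "Q1 @\<^sub>c Q2 = U * T"
    unfolding Q1_def Q2_def T_eq mult_append_cols[OF Uc T12 T_blocks(3)]
      mult_append_cols[OF Uc T_blocks(1,2)] T(2,3) ..
  have AP2: "A * P2 \<in> carrier_mat M (m - k)"
    by (rule mult_carrier_mat[OF A P2])
  have E: "E \<in> carrier_mat k l"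
    unfolding E_def by (rule mult_carrier_mat[OF mult_carrier_mat[OF Yt A] Vlc])
  define C where "C = Q1\<^sup>T * (A * P2)"

  have Y_part: "(frobenius_norm (Y\<^sup>T * (A * P2)))\<^sup>2
      = (frobenius_norm (Y\<^sup>T * (A * V)))\<^sup>2 - (frobenius_norm R)\<^sup>2 - (frobenius_norm E)\<^sup>2"
  proof -
    have AVc: "A * V \<in> carrier_mat M (m + l)"
      by (rule mult_carrier_mat[OF A Vc])
    have AWc: "A * W \<in> carrier_mat M k" and AVl: "A * Vl \<in> carrier_mat M l"
      by (rule mult_carrier_mat[OF A Wc] mult_carrier_mat[OF A Vlc])+
    note AWVl = append_cols_carrier[OF AWc AVl]
    have "(frobenius_norm (Y\<^sup>T * (A * V)))\<^sup>2 = (frobenius_norm (Y\<^sup>T * (A * V) * Z))\<^sup>2"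
      by (rule frobenius_mult_orthogonal[OF Zo mult_carrier_mat[OF Yt AVc], symmetric])
    also have "Y\<^sup>T * (A * V) * Z = Y\<^sup>T * (A * (P1 @\<^sub>c P2))"
      unfolding P_eq assoc_mult_mat[OF Yt AVc Zo(1)] assoc_mult_mat[OF A Vc Zo(1)] ..
    also have "\<dots> = (Y\<^sup>T * (A * W) @\<^sub>c Y\<^sup>T * (A * Vl)) @\<^sub>c Y\<^sup>T * (A * P2)"
      unfolding mult_append_cols[OF A P1 P2] unfolding P1_def mult_append_cols[OF A Wc Vlc]
        mult_append_cols[OF Yt AWVl AP2] mult_append_cols[OF Yt AWc AVl] ..
    also have "Y\<^sup>T * (A * Vl) = E"
      unfolding E_def by (rule assoc_mult_mat[OF Yt A Vlc, symmetric])
    also have "Y\<^sup>T * (A * W) = R"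
      unfolding AW assoc_mult_mat[OF Yt Y(1) R, symmetric] orthonormal_colsD[OF Y(2,1)]
      by (rule left_mult_one_mat[OF R])
    finally show ?thesis
      by (simp add: frobenius_append_cols[OF append_cols_carrier[OF R E] mult_carrier_mat[OF Yt AP2]]
          frobenius_append_cols[OF R E])
  qed
  have Ul_part: "(frobenius_norm (Ul\<^sup>T * (A * P2)))\<^sup>2 \<le> (\<alpha>' (l + 1))\<^sup>2"
  proof -
    have P2o: "orthonormal_cols P2"
      unfolding P2_def by (rule orthonormal_cols_mult[OF Vc Vo Z_blocks(3) Z_orth(2)])
    have "orthonormal_cols (Z2 @\<^sub>c Zc)"
      using append_cols_orthonormalD(2)[OF Z_blocks(1) append_cols_carrier[OF Z_blocks(2,3)]]
        Zo(2)[unfolded Z_blocks(4)] by blast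
    then have "Zc\<^sup>T * Z2 = 0\<^sub>m (m - k) l"
      by (rule append_cols_orthonormalD(4)[OF Z_blocks(2,3)])
    moreover have "P2\<^sup>T * Vl = Zc\<^sup>T * Z2"
    proof -
      have t: "Zc\<^sup>T \<in> carrier_mat (m - k) (m + l)" "V\<^sup>T \<in> carrier_mat (m + l) N"
        using Z_blocks Vc by simp_all
      have "P2\<^sup>T * Vl = Zc\<^sup>T * (V\<^sup>T * (V * Z2))"
        unfolding P2_def Z(3) transpose_mult[OF Vc Z_blocks(3)]
        by (rule assoc_mult_mat[OF t mult_carrier_mat[OF Vc Z_blocks(2)]])
      also have "V\<^sup>T * (V * Z2) = Z2"
        unfolding assoc_mult_mat[OF t(2) Vc Z_blocks(2), symmetric] orthonormal_colsD[OF Vo Vc]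
        by (rule left_mult_one_mat[OF Z_blocks(2)])
      finally show ?thesis .
    qed
    ultimately show ?thesis
      using recycling_gkb_tail_le[OF rgkb A P2 P2o] unfolding Ul Vl by simp
  qed
  have C_le: "(frobenius_norm C)\<^sup>2 \<le> (\<sigma> k)\<^sup>2 - (R $$ (k - 1, k - 1))\<^sup>2 + (\<alpha> (m + 1))\<^sup>2
      - (frobenius_norm E)\<^sup>2 + (\<alpha>' (l + 1))\<^sup>2"
    using captured triangular Y_part Ul_part
      frobenius_transpose_append_cols_mult[OF Y(1) Ulc AP2]
    unfolding C_def Q1_def by linarith

  \<comment> \<open>\<open>U\<close> and \<open>V\<close> have orthonormal columns, so the full problem may be written with \<open>A\<close>, \<open>Q1\<close>, \<open>Q2\<close>, \<open>P1\<close>,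
    \<open>P2\<close> in place of \<open>B\<close>, \<open>T\<close>, \<open>Z\<close>, the form in which the residual estimate applies.\<close>
  have Bhat_eq: "Bhat = four_block_mat R E (0\<^sub>m (l + 1) k) Bl"
    unfolding Bhat E_def ..
  have Bhc: "Bhat \<in> carrier_mat (k + (l + 1)) (k + l)"
    unfolding Bhat_eq by (rule four_block_carrier_mat[OF R Blc])
  have AVl: "A * Vl = Y * E + Ul * Bl"
    unfolding E_def Vl Ul Bl by (rule recycling_gkb_relation[OF rgkb A Y(1)])
  have AP1: "A * P1 = Q1 * Bhat"
    unfolding P1_def Q1_def Bhat_eq append_cols_mult_four_block[OF Y(1) Ulc R E Blc]
      mult_append_cols[OF A Wc Vlc] AW AVl ..
  have Qo: "orthonormal_cols (Q1 @\<^sub>c Q2)"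
    unfolding Q_eq by (rule orthonormal_cols_mult[OF Uc Uo Tc])
  define h where "h = \<zeta> + R *\<^sub>v unit_vec k (k - 1)"
  have \<zeta>c: "\<zeta> \<in> carrier_vec k" and Re: "R *\<^sub>v unit_vec k (k - 1) \<in> carrier_vec k"
    unfolding \<zeta> using Y(1) R by (auto intro!: carrier_vecI)
  have hc: "h \<in> carrier_vec k"
    unfolding h_def using \<zeta>c Re by simp
  have gc: "g \<in> carrier_vec (k + (l + 1))"
    unfolding g h_def[symmetric] using hc by (intro append_carrier_vec) auto
  have b_eq: "b = Q1 *\<^sub>v g"
  proof -
    have Axc: "A *\<^sub>v xc = Y *\<^sub>v (R *\<^sub>v unit_vec k (k - 1))"
    proof -
      have "xc = col W (k - 1)"
        unfolding W using k col_append_cols[OF W0c xm, of "k - 1"] xcc by simp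
      also have "\<dots> = W *\<^sub>v unit_vec k (k - 1)"
        using k by (intro mult_unit_vec[OF Wc, symmetric]) auto
      finally have "A *\<^sub>v xc = A * W *\<^sub>v unit_vec k (k - 1)"
        by (simp only: assoc_mult_mat_vec[OF A Wc unit_vec_carrier])
      then show ?thesis
        unfolding AW assoc_mult_mat_vec[OF Y(1) R unit_vec_carrier] .
    qed
    have u1: "u' 1 \<in> carrier_vec M" "0 < \<beta>' 1"
      using recycling_gkb_vectors(1,4)[OF rgkb A, of 1] by auto
    have u1_eq: "u' 1 = (1 / \<beta>' 1) \<cdot>\<^sub>v (r1 - Y *\<^sub>v \<zeta>)"
      using rgkb unfolding recycling_gkb_def by (elim conjE)
    have "\<beta>' 1 \<cdot>\<^sub>v u' 1 = r1 - Y *\<^sub>v \<zeta>"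
      using u1(2) unfolding u1_eq by (simp add: smult_smult_assoc)
    moreover have "Ul *\<^sub>v (\<beta>' 1 \<cdot>\<^sub>v unit_vec (l + 1) 0) = \<beta>' 1 \<cdot>\<^sub>v u' 1"
      using cols_upto_mult_unit_vec[of 0 "l + 1" u' M] u1(1)
      unfolding mult_mat_vec[OF Ulc unit_vec_carrier] unfolding Ul by simp
    ultimately have "Q1 *\<^sub>v g = (Y *\<^sub>v \<zeta> + A *\<^sub>v xc) + (b - A *\<^sub>v xc - Y *\<^sub>v \<zeta>)"
      unfolding Q1_def g h_def[symmetric]
        mult_append_cols_append_vec[OF Y(1) Ulc hc smult_carrier_vec[THEN iffD2, OF unit_vec_carrier]]
      unfolding h_def mult_add_distrib_mat_vec[OF Y(1) \<zeta>c Re] Axc[symmetric] r1 by simp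
    moreover have "b = (c + d) + (b - d - c)" if "c \<in> carrier_vec M" "d \<in> carrier_vec M" for c d
      using that b by (intro eq_vecI) auto
    ultimately show ?thesis
      using mult_mat_vec_carrier[OF Y(1) \<zeta>c] mult_mat_vec_carrier[OF A xcc] by simp
  qed
  have Ut: "U\<^sup>T \<in> carrier_mat (m + l + 1) M" and Tt: "T\<^sup>T \<in> carrier_mat (m + l + 1) (m + l + 1)"
    using Uc Tc by simp_all
  have G_eq: "G = (Q1 @\<^sub>c Q2)\<^sup>T * (A * (P1 @\<^sub>c P2))"
  proof -
    have BZ: "B * Z \<in> carrier_mat (m + l + 1) (m + l)"
      by (rule mult_carrier_mat[OF Bc Zo(1)])
    have "U\<^sup>T * (A * (V * Z)) = B * Z"
      unfolding assoc_mult_mat[OF A Vc Zo(1), symmetric] AV assoc_mult_mat[OF Uc Bc Zo(1)]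
        assoc_mult_mat[OF Ut Uc BZ, symmetric] orthonormal_colsD[OF Uo Uc]
      by (rule left_mult_one_mat[OF BZ])
    then show ?thesis
      unfolding G Q_eq P_eq transpose_mult[OF Uc Tc(1)]
        assoc_mult_mat[OF Tt Ut mult_carrier_mat[OF A mult_carrier_mat[OF Vc Zo(1)]]]
      by (simp only: assoc_mult_mat[OF Tt Bc Zo(1)])
  qed
  have f_eq: "T\<^sup>T *\<^sub>v (\<beta> 1 \<cdot>\<^sub>v unit_vec (m + l + 1) 0) = (Q1 @\<^sub>c Q2)\<^sup>T *\<^sub>v (Q1 *\<^sub>v g)"
  proof -
    let ?e = "\<beta> 1 \<cdot>\<^sub>v unit_vec (m + l + 1) 0 :: real vec"
    have ec: "?e \<in> carrier_vec (m + l + 1)"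
      by simp
    have u1: "u 1 \<in> carrier_vec M" "0 < \<beta> 1"
      using gkb_vectors(1)[OF gkb A, of 1] by auto
    have u1_eq: "u 1 = (1 / \<beta> 1) \<cdot>\<^sub>v b"
      using gkb unfolding gkb_def by (elim conjE)
    have "b = \<beta> 1 \<cdot>\<^sub>v u 1"
      using u1(2) unfolding u1_eq by (simp add: smult_smult_assoc)
    also have "\<dots> = U *\<^sub>v ?e"
      using cols_upto_mult_unit_vec[of 0 "m + l + 1" u M] u1(1)
      unfolding mult_mat_vec[OF Uc unit_vec_carrier] unfolding U by simp
    finally have b_Ue: "b = U *\<^sub>v ?e" .
    have "U\<^sup>T *\<^sub>v b = ?e"
      unfolding b_Ue assoc_mult_mat_vec[OF Ut Uc ec, symmetric] orthonormal_colsD[OF Uo Uc]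
      by (rule one_mult_mat_vec[OF ec])
    then show ?thesis
      unfolding b_eq[symmetric] Q_eq transpose_mult[OF Uc Tc(1)] assoc_mult_mat_vec[OF Tt Ut b] by simp
  qed
  have "(norm2 r)\<^sup>2 \<le> (norm2 rhat)\<^sup>2 * (frobenius_norm C)\<^sup>2"
    using full_residual_le[OF A Q1 Q2 Qo P1 P2 Bhc AP1 gc y G_eq f_eq]
    unfolding r rhat C_def dims .
  also have "\<dots> \<le> (norm2 rhat)\<^sup>2 * ((\<sigma> k)\<^sup>2 - (R $$ (k - 1, k - 1))\<^sup>2 + (\<alpha> (m + 1))\<^sup>2
      - (frobenius_norm E)\<^sup>2 + (\<alpha>' (l + 1))\<^sup>2)"
    by (rule mult_left_mono[OF C_le]) simp
  finally have "sqrt ((norm2 r)\<^sup>2) \<le> sqrt ((norm2 rhat)\<^sup>2 * ((\<sigma> k)\<^sup>2 - (R $$ (k - 1, k - 1))\<^sup>2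
      + (\<alpha> (m + 1))\<^sup>2 - (frobenius_norm E)\<^sup>2 + (\<alpha>' (l + 1))\<^sup>2))"
    by (rule real_sqrt_le_mono)
  then show ?thesis
    by (simp add: real_sqrt_mult norm2_nonneg E_def)
qed

end
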